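(* Let $R$ be a ring and let $A$, $B$, $C'$ be $n\times n$ matrices over $R$. Suppose that $C'$ differs from the matrix product $C=A\times B$ in $k$ entries. There is a randomized algorithm that, given only $A$, $B$, $C'$ (without any prior knowledge of $k$), transforms $C'$ into the product $A\times B$ in $O\big((n\sqrt{\log n}+\sqrt{k}\min\{k,n\})\,n\sqrt{\log n}\big)$ time almost surely, i.e., for any constant $\alpha\ge 1$ (the algorithm may depend on $\alpha$), with probability at least $1-n^{-\alpha}$ it outputs $A\times B$ within this time bound.
   Context: Running time is measured in a unit-cost model where each ring operation and elementary operation costs $O(1)$. *)

theory Defs
  imports Complex_Main
begin

text \<open>
  Two memories: a word memory (natural numbers, bounded by a word bound W = n^O(1))
  and a ring memory (entries of the ring).  Ring instructions address the ring memory
  indirectly through word registers.  Every instruction (ring operation, ring equality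
  test, word operation, jump, coin flip) costs one time unit.
\<close>

datatype instr =
    NConst nat nat
  | NAdd nat nat nat
  | NSub nat nat nat          \<comment> \<open>N i := N j - N k (truncated)\<close>
  | NMul nat nat nat
  | NDiv nat nat nat
  | NMod nat nat nat
  | NLoad nat nat
  | NStore nat nat
  | RZero nat
  | ROne nat
  | RAdd nat nat nat
  | RSub nat nat nat
  | RMul nat nat nat
  | RNeg nat nat
  | RCopy nat nat
  | Jmp nat
  | JLess nat nat nat
  | JEqN nat nat nat
  | JEqR nat nat nat
  | Coin nat
  | Halt

record 'a st =
  pc :: nat
  nmem :: "nat \<Rightarrow> nat"
  rmem :: "nat \<Rightarrow> 'a"
  ncoins :: nat

datatype 'a conf = Running "'a st" | Halted "'a st" | Crashed

definition nset :: "nat \<Rightarrow> 'a st \<Rightarrow> nat \<Rightarrow> nat \<Rightarrow> 'a conf" where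
  "nset W s i v = (if v < W then Running (s\<lparr>pc := Suc (pc s), nmem := (nmem s)(i := v)\<rparr>) else Crashed)"

definition rset :: "'a st \<Rightarrow> nat \<Rightarrow> 'a \<Rightarrow> 'a conf" where
  "rset s i v = Running (s\<lparr>pc := Suc (pc s), rmem := (rmem s)(nmem s i := v)\<rparr>)"

definition jump_if :: "'a st \<Rightarrow> bool \<Rightarrow> nat \<Rightarrow> 'a conf" where
  "jump_if s b t = Running (s\<lparr>pc := (if b then t else Suc (pc s))\<rparr>)"

fun exec_instr :: "nat \<Rightarrow> (nat \<Rightarrow> bool) \<Rightarrow> instr \<Rightarrow> 'a::ring_1 st \<Rightarrow> 'a conf" where
  "exec_instr W cs (NConst i c) s = nset W s i c"
| "exec_instr W cs (NAdd i j k) s = nset W s i (nmem s j + nmem s k)"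
| "exec_instr W cs (NSub i j k) s = nset W s i (nmem s j - nmem s k)"
| "exec_instr W cs (NMul i j k) s = nset W s i (nmem s j * nmem s k)"
| "exec_instr W cs (NDiv i j k) s = nset W s i (nmem s j div nmem s k)"
| "exec_instr W cs (NMod i j k) s = nset W s i (nmem s j mod nmem s k)"
| "exec_instr W cs (NLoad i j) s = nset W s i (nmem s (nmem s j))"
| "exec_instr W cs (NStore i j) s = nset W s (nmem s i) (nmem s j)"
| "exec_instr W cs (RZero i) s = rset s i 0"
| "exec_instr W cs (ROne i) s = rset s i 1"
| "exec_instr W cs (RAdd i j k) s = rset s i (rmem s (nmem s j) + rmem s (nmem s k))"
| "exec_instr W cs (RSub i j k) s = rset s i (rmem s (nmem s j) - rmem s (nmem s k))"
| "exec_instr W cs (RMul i j k) s = rset s i (rmem s (nmem s j) * rmem s (nmem s k))"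
| "exec_instr W cs (RNeg i j) s = rset s i (- rmem s (nmem s j))"
| "exec_instr W cs (RCopy i j) s = rset s i (rmem s (nmem s j))"
| "exec_instr W cs (Jmp t) s = jump_if s True t"
| "exec_instr W cs (JLess i j t) s = jump_if s (nmem s i < nmem s j) t"
| "exec_instr W cs (JEqN i j t) s = jump_if s (nmem s i = nmem s j) t"
| "exec_instr W cs (JEqR i j t) s = jump_if s (rmem s (nmem s i) = rmem s (nmem s j)) t"
| "exec_instr W cs (Coin i) s =
     (case nset W s i (if cs (ncoins s) then 1 else 0) of
        Running s' \<Rightarrow> Running (s'\<lparr>ncoins := Suc (ncoins s)\<rparr>)
      | c \<Rightarrow> c)"
| "exec_instr W cs Halt s = Halted s"

fun step :: "instr list \<Rightarrow> nat \<Rightarrow> (nat \<Rightarrow> bool) \<Rightarrow> 'a::ring_1 conf \<Rightarrow> 'a conf" where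
  "step P W cs (Running s) = (if pc s < length P then exec_instr W cs (P ! pc s) s else Crashed)"
| "step P W cs c = c"

definition run :: "instr list \<Rightarrow> nat \<Rightarrow> (nat \<Rightarrow> bool) \<Rightarrow> nat \<Rightarrow> 'a::ring_1 conf \<Rightarrow> 'a conf" where
  "run P W cs t c = (step P W cs ^^ t) c"

text \<open>An n\<times>n matrix over the ring is represented by a function \<open>nat \<Rightarrow> nat \<Rightarrow> 'a\<close>;
  only the entries with indices \<open>< n\<close> are relevant.\<close>

definition mat_mult :: "nat \<Rightarrow> (nat \<Rightarrow> nat \<Rightarrow> 'a::ring_1) \<Rightarrow> (nat \<Rightarrow> nat \<Rightarrow> 'a) \<Rightarrow> nat \<Rightarrow> nat \<Rightarrow> 'a" where
  "mat_mult n A B i j = (\<Sum>l<n. A i l * B l j)"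

definition num_diff :: "nat \<Rightarrow> (nat \<Rightarrow> nat \<Rightarrow> 'a) \<Rightarrow> (nat \<Rightarrow> nat \<Rightarrow> 'a) \<Rightarrow> nat" where
  "num_diff n C D = card {(i, j). i < n \<and> j < n \<and> C i j \<noteq> D i j}"

text \<open>Input layout: word register 0 holds n; ring memory holds A at addresses
  i*n+j, B at n^2+i*n+j and C' at 2n^2+i*n+j (i,j < n); everything else is 0.
  The output is read from the region of C' (the algorithm transforms C' in place).\<close>

definition init_conf :: "nat \<Rightarrow> (nat \<Rightarrow> nat \<Rightarrow> 'a::ring_1) \<Rightarrow> (nat \<Rightarrow> nat \<Rightarrow> 'a) \<Rightarrow> (nat \<Rightarrow> nat \<Rightarrow> 'a) \<Rightarrow> 'a conf" where
  "init_conf n A B C =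
     Running \<lparr> pc = 0,
               nmem = (\<lambda>_. 0)(0 := n),
               rmem = (\<lambda>a. if a < n * n then A (a div n) (a mod n)
                           else if a < 2 * (n * n) then B ((a - n * n) div n) ((a - n * n) mod n)
                           else if a < 3 * (n * n) then C ((a - 2 * (n * n)) div n) ((a - 2 * (n * n)) mod n)
                           else 0),
               ncoins = 0 \<rparr>"

definition output_ok :: "nat \<Rightarrow> (nat \<Rightarrow> nat \<Rightarrow> 'a) \<Rightarrow> 'a conf \<Rightarrow> bool" where
  "output_ok n D c = (case c of
       Halted s \<Rightarrow> (\<forall>i<n. \<forall>j<n. rmem s (2 * (n * n) + i * n + j) = D i j)
     | _ \<Rightarrow> False)"

text \<open>Probability (over fair coins) that program P, run on (A,B,C') with word bound W,
  halts within T steps with the product A\<times>B in the C' region.  Within T steps at most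
  T coins are read, so it suffices to average over all coin strings of length T.\<close>

definition succ_prob :: "instr list \<Rightarrow> nat \<Rightarrow> nat \<Rightarrow> nat \<Rightarrow> (nat \<Rightarrow> nat \<Rightarrow> 'a::ring_1) \<Rightarrow> (nat \<Rightarrow> nat \<Rightarrow> 'a) \<Rightarrow> (nat \<Rightarrow> nat \<Rightarrow> 'a) \<Rightarrow> real" where
  "succ_prob P W T n A B C =
     real (card {bs :: bool list. length bs = T \<and>
        output_ok n (mat_mult n A B) (run P W (\<lambda>i. i < length bs \<and> bs ! i) T (init_conf n A B C))})
     / 2 ^ T"

end

theory Submission
  imports Defs
begin

text \<open>
  Let \<open>E = A \<times> B - C'\<close>.  For random 0/1 vectors \<open>v\<close> the products of \<open>B\<close> with all prefixes of \<open>v\<close> are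
  tabulated in \<open>O(n\<^sup>2)\<close> time; afterwards \<open>\<Sum>j<q. E i j * v j\<close> costs \<open>O(n)\<close> for any \<open>i, q\<close>.  A nonzero value
  certifies an error among the first \<open>q\<close> entries of row \<open>i\<close>, and such an error is detected with
  probability at least 1/2.  A galloping search with these one-sided noisy tests finds the leftmost error
  of a row with high probability using only \<open>O(log n)\<close> tests; that entry is recomputed and the search is
  repeated until the row is clean.

  The same \<open>O(log n)\<close> vectors serve all searches: as errors are removed strictly from left to
  right, a row only passes through the at most \<open>n + 1\<close> states ``errors in columns \<open>\<ge> s\<close>'', so a union
  bound over \<open>n (n + 1)\<close> fixed states suffices.  Once \<open>n\<^sup>2 / log n\<close> errors have been corrected, the remaining
  rows are recomputed naively.  The total time is \<open>O(n\<^sup>2 log n + min (k n log n) n\<^sup>3)\<close>, and the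
  geometric mean of the two terms of the minimum is \<open>n\<^sup>2 sqrt (k log n)\<close>, which gives the bound for \<open>k > n\<close>.
\<close>

section \<open>Structured programs with time bounds\<close>

text \<open>A search gets by with O(log n) tests, instead of O(log n) repetitions on each of log n
  levels, because no answer is ever confirmed. A hit is a proof, so the upper end may move for good.
  A miss proves nothing, so it only shortens the stride, and a false miss is made up for by later
  doublings. A potential of the search state then contracts by a constant factor in expectation with
  every pair of tests, and O(log n) pairs make the failure probability a power of 1/n of any
  prescribed degree. Since the vectors have entries 0 and 1 only, flipping one coin changes a test
  value by plus or minus one single error, so the chance 1/2 holds in every ring. The switch at n^2
  / log n corrections balances the two methods: a correction costs O(n log n), so at this point the
  corrections have cost as much as the n^3 of the naive product. Adaptivity is confined to one
  search, whose steps use fresh coins. Between searches the coins are shared, and independence is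
  replaced by one event that refers to the input alone; once it holds, the rest of the run can be
  analysed deterministically.\<close>

datatype cond = CLess nat nat | CEqN nat nat | CEqR nat nat

datatype com = Block "instr list" | Seq com com (infixr ";;" 60) | Cond cond com com | While cond com

fun cval :: "cond \<Rightarrow> (nat \<Rightarrow> nat) \<Rightarrow> (nat \<Rightarrow> 'a) \<Rightarrow> bool" where
  "cval (CLess i j) N R = (N i < N j)"
| "cval (CEqN i j) N R = (N i = N j)"
| "cval (CEqR i j) N R = (R (N i) = R (N j))"

fun cjump :: "cond \<Rightarrow> nat \<Rightarrow> instr" where
  "cjump (CLess i j) t = JLess i j t"
| "cjump (CEqN i j) t = JEqN i j t"
| "cjump (CEqR i j) t = JEqR i j t"

fun len :: "com \<Rightarrow> nat" where
  "len (Block is) = length is"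
| "len (c1 ;; c2) = len c1 + len c2"
| "len (Cond b c1 c2) = len c1 + len c2 + 2"
| "len (While b c) = len c + 3"

text \<open>Jumps have absolute targets, so the start address \<open>p\<close> is a parameter;
  \<open>len\<close> does not depend on it, hence all targets are known before the code is emitted.
  The machine leaves the straight path only when a test succeeds, which is why the else branch comes
  first and a failing loop test falls onto the \<open>Jmp\<close> that exits.\<close>

fun comp :: "nat \<Rightarrow> com \<Rightarrow> instr list" where
  "comp p (Block is) = is"
| "comp p (c1 ;; c2) = comp p c1 @ comp (p + len c1) c2"
| "comp p (Cond b c1 c2) =
     cjump b (p + 2 + len c2) # comp (p + 1) c2 @
     Jmp (p + 2 + len c2 + len c1) # comp (p + 2 + len c2) c1"
| "comp p (While b c) = cjump b (p + 2) # Jmp (p + 3 + len c) # comp (p + 2) c @ [Jmp p]"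

lemma length_comp [simp]: "length (comp p c) = len c"
  by (induction c arbitrary: p) auto

definition code_at :: "instr list \<Rightarrow> nat \<Rightarrow> instr list \<Rightarrow> bool" where
  "code_at P p xs = (\<exists>ys zs. P = ys @ xs @ zs \<and> length ys = p)"

lemma code_at_append: "code_at P p (xs @ ys) \<longleftrightarrow> code_at P p xs \<and> code_at P (p + length xs) ys"
proof
  assume "code_at P p (xs @ ys)"
  then obtain us zs where *: "P = us @ (xs @ ys) @ zs" "length us = p" by (auto simp: code_at_def)
  have "P = us @ xs @ (ys @ zs)" "P = (us @ xs) @ ys @ zs" "length (us @ xs) = p + length xs"
    using * by auto
  then show "code_at P p xs \<and> code_at P (p + length xs) ys"
    unfolding code_at_def using *(2) by blast
next
  assume "code_at P p xs \<and> code_at P (p + length xs) ys"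
  then obtain us zs us' zs' where *: "P = us @ xs @ zs" "length us = p"
    "P = us' @ ys @ zs'" "length us' = p + length xs" unfolding code_at_def by blast
  then have "(us @ xs) @ zs = us' @ (ys @ zs')" "length (us @ xs) = length us'" by auto
  then have "us @ xs = us'" "zs = ys @ zs'" using append_eq_append_conv by blast+
  then show "code_at P p (xs @ ys)" unfolding code_at_def using * by (intro exI[of _ us] exI[of _ zs']) auto
qed

lemma code_at_Cons: "code_at P p (x # xs) \<longleftrightarrow> p < length P \<and> P ! p = x \<and> code_at P (Suc p) xs"
proof -
  have "code_at P p [x] \<longleftrightarrow> p < length P \<and> P ! p = x"
  proof
    assume "p < length P \<and> P ! p = x"
    then show "code_at P p [x]" unfolding code_at_def
      by (intro exI[of _ "take p P"] exI[of _ "drop (Suc p) P"]) (auto simp: id_take_nth_drop)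
  qed (auto simp: code_at_def nth_append)
  then show ?thesis using code_at_append[of P p "[x]" xs] by auto
qed

abbreviation mk :: "nat \<Rightarrow> (nat \<Rightarrow> nat) \<Rightarrow> (nat \<Rightarrow> 'a) \<Rightarrow> nat \<Rightarrow> 'a st" where
  "mk p N R k \<equiv> \<lparr>pc = p, nmem = N, rmem = R, ncoins = k\<rparr>"

text \<open>\<open>ex W cs c b Q N R k\<close>: wherever the compiled command \<open>c\<close> is placed in a program, running it
  with word memory \<open>N\<close>, ring memory \<open>R\<close> and \<open>k\<close> coins already consumed reaches the instruction after
  it within \<open>b\<close> steps, in a state satisfying \<open>Q\<close>.\<close>

definition ex :: "nat \<Rightarrow> (nat \<Rightarrow> bool) \<Rightarrow> com \<Rightarrow> nat \<Rightarrow> ((nat \<Rightarrow> nat) \<Rightarrow> (nat \<Rightarrow> 'a::ring_1) \<Rightarrow> nat \<Rightarrow> bool) \<Rightarrow>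
    (nat \<Rightarrow> nat) \<Rightarrow> (nat \<Rightarrow> 'a) \<Rightarrow> nat \<Rightarrow> bool" where
  "ex W cs c b Q N R k \<longleftrightarrow> (\<forall>P p. code_at P p (comp p c) \<longrightarrow>
     (\<exists>t\<le>b. \<exists>N' R' k'. run P W cs t (Running (mk p N R k)) = Running (mk (p + len c) N' R' k') \<and> Q N' R' k'))"

lemma run_add: "run P W cs (s + t) c = run P W cs t (run P W cs s c)"
  unfolding run_def by (subst add.commute) (simp add: funpow_add)

lemma run_Suc: "run P W cs (Suc t) c = run P W cs t (step P W cs c)"
  unfolding run_def by (simp add: funpow_swap1)

lemma run_0 [simp]: "run P W cs 0 c = c"
  unfolding run_def by simp

lemma ex_mono:
  assumes "ex W cs c b Q N R k" "b \<le> b'" "\<And>N R k. Q N R k \<Longrightarrow> Q' N R k"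
  shows "ex W cs c b' Q' N R k"
  using assms unfolding ex_def by (meson order_trans)

lemma ex_Seq:
  assumes "ex W cs c1 ba (\<lambda>N R k. ex W cs c2 bc Q N R k) N R k" "ba + bc \<le> b"
  shows "ex W cs (c1 ;; c2) b Q N R k"
  unfolding ex_def
proof (intro allI impI)
  fix P p assume "code_at P p (comp p (c1 ;; c2))"
  then have c: "code_at P p (comp p c1)" "code_at P (p + len c1) (comp (p + len c1) c2)"
    by (auto simp: code_at_append)
  from c(1) assms(1) obtain t N' R' k' where 1: "t \<le> ba"
    "run P W cs t (Running (mk p N R k)) = Running (mk (p + len c1) N' R' k')" "ex W cs c2 bc Q N' R' k'"
    unfolding ex_def[of _ _ c1] by blast
  from c(2) 1(3) obtain t' N'' R'' k'' where 2: "t' \<le> bc"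
    "run P W cs t' (Running (mk (p + len c1) N' R' k')) = Running (mk (p + len c1 + len c2) N'' R'' k'')"
    "Q N'' R'' k''"
    unfolding ex_def by blast
  show "\<exists>t\<le>b. \<exists>N' R' k'. run P W cs t (Running (mk p N R k)) =
      Running (mk (p + len (c1 ;; c2)) N' R' k') \<and> Q N' R' k'"
    using 1 2 assms(2) by (intro exI[of _ "t + t'"]) (auto simp: run_add add.assoc)
qed

lemma step_cjump:
  assumes "p < length P" "P ! p = cjump b t"
  shows "step P W cs (Running (mk p N R k)) = Running (mk (if cval b N R then t else Suc p) N R k)"
  using assms by (cases b) (auto simp: jump_if_def)

lemma ex_Cond:
  assumes "cval b N R \<Longrightarrow> ex W cs c1 ba Q N R k" "\<not> cval b N R \<Longrightarrow> ex W cs c2 bc Q N R k"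
    and "ba + 1 \<le> bb" "bc + 2 \<le> bb"
  shows "ex W cs (Cond b c1 c2) bb Q N R k"
  unfolding ex_def
proof (intro allI impI)
  fix P p assume "code_at P p (comp p (Cond b c1 c2))"
  then have c: "p < length P" "P ! p = cjump b (p + 2 + len c2)"
    "code_at P (Suc p) (comp (Suc p) c2)" "Suc p + len c2 < length P"
    "P ! (Suc p + len c2) = Jmp (p + 2 + len c2 + len c1)"
    "code_at P (p + 2 + len c2) (comp (p + 2 + len c2) c1)"
    by (auto simp: code_at_append code_at_Cons)
  let ?p = "p + len (Cond b c1 c2)"
  show "\<exists>t\<le>bb. \<exists>N' R' k'. run P W cs t (Running (mk p N R k)) = Running (mk ?p N' R' k') \<and> Q N' R' k'"
  proof (cases "cval b N R")
    case True
    from assms(1)[OF True] c(6) obtain t N' R' k' where 1: "t \<le> ba"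
      "run P W cs t (Running (mk (p + 2 + len c2) N R k)) = Running (mk (p + 2 + len c2 + len c1) N' R' k')"
      "Q N' R' k'" unfolding ex_def by blast
    have e: "p + 2 + len c2 + len c1 = ?p" by simp
    show ?thesis using 1 assms(3) True step_cjump[OF c(1,2), of W cs N R k] unfolding e
      by (intro exI[of _ "Suc t"]) (auto simp: run_Suc)
  next
    case False
    from assms(2)[OF False] c(3) obtain t N' R' k' where 1: "t \<le> bc"
      "run P W cs t (Running (mk (Suc p) N R k)) = Running (mk (Suc p + len c2) N' R' k')"
      "Q N' R' k'" unfolding ex_def by blast
    have s: "step P W cs (Running (mk (Suc p + len c2) N' R' k')) = Running (mk ?p N' R' k')"
      using c(4,5) by (simp add: jump_if_def algebra_simps)
    have "run P W cs (Suc t + 1) (Running (mk p N R k)) = Running (mk ?p N' R' k')"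
      unfolding run_add run_Suc step_cjump[OF c(1,2)] using False 1(2) s by (simp add: run_Suc del: step.simps)
    then show ?thesis using 1 assms(4) by (intro exI[of _ "Suc t + 1"]) auto
  qed
qed

text \<open>The number \<open>J\<close> of iterations is fixed in advance and the invariant is
  indexed by it, so termination needs no variant. An iteration pays its body, the taken test and the
  jump back; leaving pays the failed test and the exit jump. The budget \<open>T j\<close> may vary
  with \<open>j\<close>, as it does for the rows of the matrix.\<close>

lemma ex_While:
  assumes "I 0 N R k"
    and body: "\<And>j N R k. j < J \<Longrightarrow> I j N R k \<Longrightarrow> cval b N R \<and> ex W cs c (T j) (I (Suc j)) N R k"
    and exit: "\<And>N R k. I J N R k \<Longrightarrow> \<not> cval b N R \<and> Q N R k"
    and bb: "(\<Sum>j<J. T j + 2) + 2 \<le> bb"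
  shows "ex W cs (While b c) bb Q N R k"
  unfolding ex_def
proof (intro allI impI)
  fix P p assume "code_at P p (comp p (While b c))"
  then have c: "p < length P" "P ! p = cjump b (p + 2)" "Suc p < length P" "P ! Suc p = Jmp (p + 3 + len c)"
    "code_at P (p + 2) (comp (p + 2) c)" "p + 2 + len c < length P" "P ! (p + 2 + len c) = Jmp p"
    by (auto simp: code_at_append code_at_Cons)
  let ?p = "p + len (While b c)"
  have "\<exists>t\<le>(\<Sum>j<i. T j + 2). \<exists>N' R' k'. run P W cs t (Running (mk p N R k)) = Running (mk p N' R' k') \<and> I i N' R' k'"
    if "i \<le> J" for i using that
  proof (induction i)
    case 0
    then show ?case using assms(1) by auto
  next
    case (Suc i)
    then obtain t N1 R1 k1 where 1: "t \<le> (\<Sum>j<i. T j + 2)"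
      "run P W cs t (Running (mk p N R k)) = Running (mk p N1 R1 k1)" "I i N1 R1 k1" by auto
    from body[OF _ 1(3)] Suc.prems have 2: "cval b N1 R1" "ex W cs c (T i) (I (Suc i)) N1 R1 k1" by auto
    from 2(2) c(5) obtain t' N2 R2 k2 where 3: "t' \<le> T i"
      "run P W cs t' (Running (mk (p + 2) N1 R1 k1)) = Running (mk (p + 2 + len c) N2 R2 k2)"
      "I (Suc i) N2 R2 k2" unfolding ex_def by blast
    have s: "step P W cs (Running (mk (p + 2 + len c) N2 R2 k2)) = Running (mk p N2 R2 k2)"
      using c(6,7) by (simp add: jump_if_def)
    have "run P W cs (t + (Suc t' + 1)) (Running (mk p N R k)) = Running (mk p N2 R2 k2)"
      unfolding run_add run_Suc 1(2) step_cjump[OF c(1,2)] using 2(1) 3(2) s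
      by (simp add: run_Suc del: step.simps)
    then show ?case using 1(1) 3(1,3) by (intro exI[of _ "t + (Suc t' + 1)"]) auto
  qed
  from this[of J] obtain t N1 R1 k1 where 1: "t \<le> (\<Sum>j<J. T j + 2)"
      "run P W cs t (Running (mk p N R k)) = Running (mk p N1 R1 k1)" "I J N1 R1 k1" by auto
  have s: "step P W cs (Running (mk (Suc p) N1 R1 k1)) = Running (mk ?p N1 R1 k1)"
    using c(3,4) by (simp add: jump_if_def algebra_simps)
  have "run P W cs (t + 2) (Running (mk p N R k)) = Running (mk ?p N1 R1 k1)"
    unfolding run_add 1(2) numeral_2_eq_2 run_Suc step_cjump[OF c(1,2)] using exit[OF 1(3)] s
    by (simp add: run_Suc del: step.simps)
  then show "\<exists>t\<le>bb. \<exists>N' R' k'. run P W cs t (Running (mk p N R k)) = Running (mk ?p N' R' k') \<and> Q N' R' k'"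
    using exit[OF 1(3)] 1(1) bb by (intro exI[of _ "t + 2"]) auto
qed

lemma ex_While_const:
  assumes "I 0 N R k"
    and "\<And>j N R k. j < J \<Longrightarrow> I j N R k \<Longrightarrow> cval b N R \<and> ex W cs c T (I (Suc j)) N R k"
    and "\<And>N R k. I J N R k \<Longrightarrow> \<not> cval b N R \<and> Q N R k"
    and "J * (T + 2) + 2 \<le> bb"
  shows "ex W cs (While b c) bb Q N R k"
  by (rule ex_While[where I = I and J = J and T = "\<lambda>_. T"]) (use assms in auto)

text \<open>Weakest preconditions of straight-line code; the conjuncts \<open>< W\<close> are the
  overflow checks on which the machine would crash. The final clause rejects all other instructions,
  jumps and \<open>Halt\<close> among them, so an accepted block runs through to its end with one
  step per instruction.\<close>

fun wpb :: "nat \<Rightarrow> (nat \<Rightarrow> bool) \<Rightarrow> instr list \<Rightarrow> ((nat \<Rightarrow> nat) \<Rightarrow> (nat \<Rightarrow> 'a::ring_1) \<Rightarrow> nat \<Rightarrow> bool) \<Rightarrow>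
    (nat \<Rightarrow> nat) \<Rightarrow> (nat \<Rightarrow> 'a) \<Rightarrow> nat \<Rightarrow> bool" where
  "wpb W cs [] Q N R k = Q N R k"
| "wpb W cs (NConst i c # is) Q N R k = (c < W \<and> wpb W cs is Q (N(i := c)) R k)"
| "wpb W cs (NAdd i j l # is) Q N R k = (N j + N l < W \<and> wpb W cs is Q (N(i := N j + N l)) R k)"
| "wpb W cs (NSub i j l # is) Q N R k = (N j - N l < W \<and> wpb W cs is Q (N(i := N j - N l)) R k)"
| "wpb W cs (NMul i j l # is) Q N R k = (N j * N l < W \<and> wpb W cs is Q (N(i := N j * N l)) R k)"
| "wpb W cs (NDiv i j l # is) Q N R k = (N j div N l < W \<and> wpb W cs is Q (N(i := N j div N l)) R k)"
| "wpb W cs (NMod i j l # is) Q N R k = (N j mod N l < W \<and> wpb W cs is Q (N(i := N j mod N l)) R k)"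
| "wpb W cs (RZero i # is) Q N R k = wpb W cs is Q N (R(N i := 0)) k"
| "wpb W cs (ROne i # is) Q N R k = wpb W cs is Q N (R(N i := 1)) k"
| "wpb W cs (RAdd i j l # is) Q N R k = wpb W cs is Q N (R(N i := R (N j) + R (N l))) k"
| "wpb W cs (RMul i j l # is) Q N R k = wpb W cs is Q N (R(N i := R (N j) * R (N l))) k"
| "wpb W cs (RCopy i j # is) Q N R k = wpb W cs is Q N (R(N i := R (N j))) k"
| "wpb W cs (Coin i # is) Q N R k = (1 < W \<and> wpb W cs is Q (N(i := if cs k then 1 else 0)) R (Suc k))"
| "wpb W cs (_ # is) Q N R k = False"

lemma wpb_run:
  assumes "wpb W cs is Q N R k" "code_at P p is"
  shows "\<exists>N' R' k'. run P W cs (length is) (Running (mk p N R k)) = Running (mk (p + length is) N' R' k') \<and> Q N' R' k'"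
  using assms
proof (induction "is" arbitrary: N R k p)
  case (Cons i "is")
  have c: "p < length P" "P ! p = i" "code_at P (Suc p) is" using Cons.prems(2) by (auto simp: code_at_Cons)
  have "\<exists>N1 R1 k1. exec_instr W cs i (mk p N R k) = Running (mk (Suc p) N1 R1 k1) \<and> wpb W cs is Q N1 R1 k1"
    using Cons.prems(1) by (cases i) (auto simp: nset_def rset_def)
  then obtain N1 R1 k1 where 1: "exec_instr W cs i (mk p N R k) = Running (mk (Suc p) N1 R1 k1)"
    "wpb W cs is Q N1 R1 k1" by blast
  from Cons.IH[OF 1(2) c(3)] show ?case using 1(1) c(1,2) by (auto simp: run_Suc)
qed auto

lemma ex_Block:
  assumes "wpb W cs is Q N R k" "length is \<le> b"
  shows "ex W cs (Block is) b Q N R k"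
  unfolding ex_def using assms wpb_run by (metis comp.simps(1) len.simps(1))

lemma ex_Block_Seq:
  assumes "wpb W cs is (\<lambda>N R k. ex W cs c bc Q N R k) N R k" "length is + bc \<le> b"
  shows "ex W cs (Block is ;; c) b Q N R k"
  by (rule ex_Seq[where ba = "length is" and bc = bc]) (use assms in \<open>auto intro: ex_Block\<close>)

section \<open>Noisy search for the leftmost error\<close>

text \<open>The coins are read as consecutive blocks of length \<open>n\<close>. Block
  \<open>t\<close> is the \<open>t\<close>-th random 0/1 vector, and the sum is its product with the
  first \<open>q\<close> entries of \<open>e\<close>.\<close>

definition psum :: "nat \<Rightarrow> (nat \<Rightarrow> 'a::ring_1) \<Rightarrow> (nat \<Rightarrow> bool) \<Rightarrow> nat \<Rightarrow> nat \<Rightarrow> 'a" where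
  "psum n e cs t q = (\<Sum>j<q. if cs (t * n + j) then e j else 0)"

text \<open>A miss sets no lower end: it only shrinks the stride, so a false miss excludes no
  column. Rounding up keeps the stride at 1 once it is there. As subtraction on \<open>nat\<close>
  truncates, a stride beyond the upper end tests the empty prefix, which is always a miss.\<close>

definition gallop :: "bool \<Rightarrow> nat \<times> nat \<Rightarrow> nat \<times> nat" where
  "gallop b s = (if b then (fst s - snd s, 2 * snd s) else (fst s, (snd s + 1) div 2))"

text \<open>Two vectors per step push the chance of a false miss down to 1/4. With a single one the
  drift bound would be 1/2 * 1/2 + 1/2 * 2 = 5/4; with two it is 3/4 * 1/2 + 1/4 * 2 = 7/8.\<close>

definition detect :: "nat \<Rightarrow> (nat \<Rightarrow> 'a::ring_1) \<Rightarrow> (nat \<Rightarrow> bool) \<Rightarrow> nat \<Rightarrow> nat \<Rightarrow> bool" where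
  "detect n e cs t q \<longleftrightarrow> psum n e cs t q \<noteq> 0 \<or> psum n e cs (Suc t) q \<noteq> 0"

text \<open>The state is \<open>(h, g)\<close>: an error is known to lie in a column \<open>< h\<close> (\<open>h = n + 1\<close> if none is known yet),
  and the next test looks at the prefix that is shorter by the current stride \<open>g\<close>.\<close>

fun search :: "nat \<Rightarrow> (nat \<Rightarrow> 'a::ring_1) \<Rightarrow> (nat \<Rightarrow> bool) \<Rightarrow> nat \<Rightarrow> nat \<times> nat" where
  "search n e cs 0 = (n + 1, 1)"
| "search n e cs (Suc m) =
     (let s = search n e cs m in gallop (detect n e cs (2 * m) (fst s - snd s)) s)"

text \<open>One plus the column of the leftmost error, and \<open>n + 1\<close> for an error-free row.\<close>

definition first_err :: "nat \<Rightarrow> (nat \<Rightarrow> 'a::zero) \<Rightarrow> nat" where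
  "first_err n e = (LEAST x. x = n + 1 \<or> (1 \<le> x \<and> x \<le> n \<and> e (x - 1) \<noteq> 0))"

lemma first_err_cases: "first_err n e = n + 1 \<or> (1 \<le> first_err n e \<and> first_err n e \<le> n \<and> e (first_err n e - 1) \<noteq> 0)"
  unfolding first_err_def by (rule LeastI[of _ "n + 1"]) simp

lemma first_err_le: "first_err n e \<le> n + 1"
  using first_err_cases[of n e] by auto

lemma zero_before_first_err:
  assumes "j + 1 < first_err n e" shows "e j = 0"
proof (rule ccontr)
  assume "e j \<noteq> 0"
  then have "j + 1 \<le> n \<Longrightarrow> first_err n e \<le> j + 1"
    unfolding first_err_def by (intro Least_le) auto
  then show False using assms first_err_le[of n e] by auto
qed

text \<open>This is the one-sidedness of the tests: all summands vanish whatever the coins are, so a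
  hit is always truthful.\<close>

lemma psum_zero:
  assumes "q < first_err n e" shows "psum n e cs t q = 0"
  unfolding psum_def using zero_before_first_err[of _ n e] assms by (intro sum.neutral) auto

section \<open>Counting coin strings: the chance of a false miss\<close>

definition coins :: "bool list \<Rightarrow> nat \<Rightarrow> bool" where
  "coins bs = (\<lambda>i. i < length bs \<and> bs ! i)"

lemma finite_bool_lists [simp]: "finite {bs :: bool list. length bs = n}"
  using finite_lists_length_eq[of "UNIV :: bool set" n] by simp

lemma card_bool_lists: "card {bs :: bool list. length bs = n} = 2 ^ n"
  using card_lists_length_eq[of "UNIV :: bool set" n] by simp

lemma bij_betw_append_lists:
  "bij_betw (\<lambda>(xs, ys). xs @ ys) ({xs. length xs = a} \<times> {ys. length ys = b}) {zs. length zs = a + b}"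
proof (rule bij_betw_imageI)
  show "(\<lambda>(xs, ys). xs @ ys) ` ({xs. length xs = a} \<times> {ys. length ys = b}) = {zs. length zs = a + b}"
  proof (intro equalityI subsetI)
    fix zs assume "zs \<in> {zs. length zs = a + b}"
    then show "zs \<in> (\<lambda>(xs, ys). xs @ ys) ` ({xs. length xs = a} \<times> {ys. length ys = b})"
      by (intro image_eqI[of _ _ "(take a zs, drop a zs)"]) auto
  qed auto
qed (auto simp: inj_on_def)

text \<open>Independence of disjoint blocks of coins in counting form: the average over a whole
  string is an iterated average over its two parts.\<close>

lemma sum_bool_lists_append:
  fixes f :: "bool list \<Rightarrow> real"
  shows "(\<Sum>zs | length zs = a + b. f zs) = (\<Sum>xs | length xs = a. \<Sum>ys | length ys = b. f (xs @ ys))"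
proof -
  have "(\<Sum>zs | length zs = a + b. f zs) =
      (\<Sum>p\<in>{xs. length xs = a} \<times> {ys. length ys = b}. f (case p of (xs, ys) \<Rightarrow> xs @ ys))"
    by (rule sum.reindex_bij_betw[OF bij_betw_append_lists, symmetric])
  then show ?thesis by (simp add: sum.cartesian_product case_prod_unfold)
qed

text \<open>Flipping the coin of an erroneous column changes the sum.\<close>

lemma card_psum_zero:
  fixes e :: "nat \<Rightarrow> 'a::ring_1"
  assumes "first_err n e \<le> q" "q \<le> n"
  shows "2 * card {zs. length zs = n \<and> psum n e (coins zs) 0 q = 0} \<le> 2 ^ n"
proof -
  let ?Z = "{zs. length zs = n \<and> psum n e (coins zs) 0 q = 0}"
  define j where "j = first_err n e - 1"
  have j: "j < q" "e j \<noteq> 0" using first_err_cases[of n e] assms by (auto simp: j_def)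
  define f where "f zs = zs[j := \<not> zs ! j]" for zs :: "bool list"
  have jn: "j < n" using j assms by simp
  have ff: "f (f zs) = zs" if "length zs = n" for zs using that jn by (simp add: f_def)
  have inj: "inj_on f ?Z" by (rule inj_on_inverseI[of _ f]) (use ff in auto)
  have *: "psum n e (coins (f zs)) 0 q \<noteq> 0" if "zs \<in> ?Z" for zs
  proof -
    have l: "length zs = n" "psum n e (coins zs) 0 q = 0" using that by auto
    let ?r = "\<lambda>zs. \<Sum>i\<in>{..<q} - {j}. if coins zs i then e i else 0"
    have r: "?r (f zs) = ?r zs" by (rule sum.cong) (auto simp: f_def coins_def)
    have s: "psum n e (coins zs') 0 q = (if coins zs' j then e j else 0) + ?r zs'" for zs'
      using j by (simp add: psum_def sum.remove[of _ j])
    show ?thesis using s[of zs] s[of "f zs"] r j(2) l jn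
      by (auto simp: f_def coins_def split: if_splits)
  qed
  have "f ` ?Z \<inter> ?Z = {}" using * by auto
  then have "card ?Z + card ?Z = card (f ` ?Z \<union> ?Z)"
    by (subst card_Un_disjoint) (auto simp: card_image[OF inj] intro: rev_finite_subset[OF finite_bool_lists[of n]])
  also have "\<dots> \<le> card {zs :: bool list. length zs = n}"
    by (rule card_mono) (auto simp: f_def)
  finally show ?thesis by (simp add: card_bool_lists)
qed

text \<open>Cutting off \<open>t\<close> whole blocks renumbers the later vectors. Together with the
  next lemma this shows that a test reads only the coins of its own block, the source of
  independence between the steps of a search.\<close>

lemma psum_coins_append:
  assumes "length xs = t * n"
  shows "psum n e (coins (xs @ ys)) (t + a) q = psum n e (coins ys) a q"
  unfolding psum_def by (rule sum.cong) (auto simp: assms coins_def nth_append algebra_simps)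

lemma psum_coins_take:
  assumes "length xs = m * n" "t < m" "q \<le> n"
  shows "psum n e (coins (xs @ ys)) t q = psum n e (coins xs) t q"
proof -
  have "t * n + j < m * n" if "j < q" for j
  proof -
    have "t * n + j < Suc t * n" using that assms by simp
    also have "\<dots> \<le> m * n" using assms by (intro mult_right_mono) auto
    finally show ?thesis .
  qed
  then have "coins (xs @ ys) (t * n + j) = coins xs (t * n + j)" if "j < q" for j
    using that by (auto simp: assms coins_def nth_append trans_less_add1)
  then show ?thesis unfolding psum_def by (intro sum.cong) auto
qed

text \<open>A pair of vectors misses only if each half of the coin string misses on its own. Such
  strings are concatenations from \<open>?Z \<times> ?Z\<close>, and \<open>?Z\<close> holds at most
  half of the strings of length \<open>n\<close>.\<close>

lemma card_not_detect:
  fixes e :: "nat \<Rightarrow> 'a::ring_1"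
  assumes "first_err n e \<le> q" "q \<le> n"
  shows "4 * card {ys. length ys = 2 * n \<and> \<not> detect n e (coins ys) 0 q} \<le> 2 ^ (2 * n)"
proof -
  let ?Z = "{zs. length zs = n \<and> psum n e (coins zs) 0 q = 0}"
  let ?Y = "{ys. length ys = 2 * n \<and> \<not> detect n e (coins ys) 0 q}"
  have fin: "finite ?Z" by (rule rev_finite_subset[OF finite_bool_lists[of n]]) auto
  have "?Y \<subseteq> (\<lambda>(xs, ys). xs @ ys) ` (?Z \<times> ?Z)"
  proof
    fix ys assume "ys \<in> ?Y"
    then have l: "length ys = 2 * n" and z: "psum n e (coins ys) 0 q = 0" "psum n e (coins ys) (Suc 0) q = 0"
      by (auto simp: detect_def)
    have ys: "ys = take n ys @ drop n ys" and t: "length (take n ys) = 1 * n" and d: "length (drop n ys) = n" using l by auto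
    have "psum n e (coins (take n ys)) 0 q = 0"
      using z(1) psum_coins_take[OF t, of 0 q e "drop n ys"] assms by simp
    moreover have "psum n e (coins (drop n ys)) 0 q = 0"
      using z(2) psum_coins_append[OF t, of e "drop n ys" 0 q] by simp
    ultimately show "ys \<in> (\<lambda>(xs, ys). xs @ ys) ` (?Z \<times> ?Z)"
      using ys t d by (intro image_eqI[of _ _ "(take n ys, drop n ys)"]) auto
  qed
  then have "card ?Y \<le> card (?Z \<times> ?Z)" by (rule surj_card_le[rotated]) (use fin in auto)
  then have "4 * card ?Y \<le> (2 * card ?Z) * (2 * card ?Z)" by (simp add: card_cartesian_product)
  also have "\<dots> \<le> 2 ^ n * 2 ^ n" using card_psum_zero[OF assms] by (intro mult_mono) auto
  finally show ?thesis by (simp add: mult_2 power_add)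
qed

text \<open>Potential of a search state at distance \<open>d\<close> from its target with stride \<open>g\<close>.  A hit halves it, a miss
  at most doubles it if \<open>g \<le> d\<close> (where misses have probability at most 1/4) and halves it otherwise, so
  it shrinks by 7/8 in expectation.  The factor 4 makes up for the step across \<open>g = d\<close>.\<close>

definition pot :: "nat \<Rightarrow> nat \<Rightarrow> real" where
  "pot d g = (if d = 0 then 0 else if g \<le> d then real d ^ 5 / real g else 4 * real d ^ 3 * real g)"

lemma pot_nonneg: "0 \<le> pot d g"
  by (simp add: pot_def)

text \<open>The link from expectation to probability: every search that is still off its target
  contributes at least 1 to the summed potential.\<close>

lemma pot_ge_1: assumes "d > 0" "g > 0" shows "1 \<le> pot d g"
proof (cases "g \<le> d")
  case True
  have "real g \<le> real d * 1 ^ 4" using True by simp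
  also have "\<dots> \<le> real d * real d ^ 4" using assms by (intro mult_left_mono power_mono) auto
  finally show ?thesis using True assms by (simp add: pot_def field_simps power_numeral_reduce)
next
  case False
  have "1 * 1 \<le> (4 * real d ^ 3) * real g"
    using assms one_le_power[of "real d" 3] by (intro mult_mono) linarith+
  then show ?thesis using False assms by (simp add: pot_def)
qed

lemma half_pow2: "((2::nat) ^ Suc k + 1) div 2 = 2 ^ k"
  by simp

text \<open>The delicate case is a stride g above d whose half l is at most d, where
  \<open>pot\<close> changes branch. The claim then reduces to d^2 \<le> (2 l)^2, and the factor 4
  in \<open>pot\<close> is what supplies the 2^2.\<close>

lemma pot_miss_far:
  assumes "0 < d" "d < 2 ^ k"
  shows "pot d ((2 ^ k + 1) div 2) \<le> 1/2 * pot d (2 ^ k)"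
proof -
  obtain l where l: "k = Suc l" using assms by (cases k) auto
  let ?g = "real (2 ^ l)"
  have g: "?g > 0" by simp
  have d: "real d < 2 * ?g" using assms(2) l by (simp flip: of_nat_less_iff[where 'a = real])
  show ?thesis
  proof (cases "2 ^ l \<le> d")
    case True
    have "real d ^ 3 * real d ^ 2 \<le> real d ^ 3 * (2 * ?g) ^ 2"
      using d by (intro mult_left_mono power_mono) auto
    then have "real d ^ 5 \<le> 4 * real d ^ 3 * ?g * ?g" by (simp add: power2_eq_square power_numeral_reduce algebra_simps)
    then have "real d ^ 5 / ?g \<le> 4 * real d ^ 3 * ?g" using g by (simp add: field_simps)
    then show ?thesis using True assms l by (simp add: pot_def half_pow2 mult_ac)
  next
    case False
    then show ?thesis using assms l by (simp add: pot_def half_pow2)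
  qed
qed

lemma pot_miss_near:
  assumes "0 < d" "2 ^ k \<le> d"
  shows "pot d ((2 ^ k + 1) div 2) \<le> 2 * pot d (2 ^ k)"
proof (cases k)
  case 0
  then show ?thesis using pot_nonneg[of d 1] by simp
next
  case (Suc l)
  then have "2 ^ l \<le> d" using assms by simp
  then show ?thesis using assms Suc by (simp add: pot_def half_pow2)
qed

text \<open>After the hit the distance is a = d - g and the stride 2 g. If 2 g \<le> a, monotonicity
  of the fifth power suffices; otherwise \<open>pot\<close> changes branch and the claim becomes 16
  a^3 g^2 \<le> (a + g)^5.\<close>

lemma pot_hit:
  assumes "0 < g" "g \<le> d"
  shows "pot (d - g) (2 * g) \<le> 1/2 * pot d g"
proof -
  define a where "a = real (d - g)"
  let ?g = "real g"
  have d: "real d = a + ?g" using assms by (simp add: a_def of_nat_diff)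
  have a: "a \<ge> 0" and g: "?g > 0" using assms by (auto simp: a_def)
  consider "d - g = 0" | "d - g > 0" "2 * g \<le> d - g" | "d - g > 0" "\<not> 2 * g \<le> d - g" by linarith
  then show ?thesis
  proof cases
    case 1
    then show ?thesis using pot_nonneg[of d g] by (simp add: pot_def)
  next
    case 2
    have "a ^ 5 \<le> real d ^ 5" using a g d by (intro power_mono) auto
    then show ?thesis using 2 assms g by (simp add: pot_def a_def divide_right_mono)
  next
    case 3
    have "16 * a ^ 3 * ?g ^ 2 \<le> (a + ?g) ^ 5"
    proof -
      \<comment> \<open>A square absorbs the only negative coefficient, that of a^3 g^2, which is 10
        - 16 = -6.\<close>
      have "(a + ?g) ^ 5 - 16 * a ^ 3 * ?g ^ 2 =
          3 * a ^ 2 * ?g * (a - ?g) ^ 2 + a ^ 5 + 2 * a ^ 4 * ?g + 7 * a ^ 2 * ?g ^ 3 + 5 * a * ?g ^ 4 + ?g ^ 5"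
        by (simp add: power_numeral_reduce algebra_simps)
      also have "\<dots> \<ge> 0" using a g by (intro add_nonneg_nonneg mult_nonneg_nonneg) auto
      finally show ?thesis by simp
    qed
    then have "8 * a ^ 3 * ?g \<le> 1/2 * (real d ^ 5 / ?g)"
      using g d by (simp add: field_simps power2_eq_square)
    then show ?thesis using 3 assms by (simp add: pot_def a_def)
  qed
qed

section \<open>Drift of the potential along a search and the resulting failure bound\<close>

lemma search_inv:
  "first_err n e \<le> fst (search n e cs m) \<and> fst (search n e cs m) \<le> n + 1 \<and> (\<exists>k. snd (search n e cs m) = 2 ^ k) \<and>
   snd (search n e cs m) \<le> 2 * (n + 1)"
proof (induction m)
  case 0
  show ?case using first_err_le[of n e] by (auto intro: exI[of _ 0])
next
  case (Suc m)
  obtain h g where s: "search n e cs m = (h, g)" by fastforce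
  obtain k where k: "g = 2 ^ k" using Suc s by auto
  have hg: "first_err n e \<le> h" "h \<le> n + 1" "g \<le> 2 * (n + 1)" using Suc s by auto
  show ?case
  proof (cases "detect n e cs (2 * m) (h - g)")
    case True
    then have "first_err n e \<le> h - g" using psum_zero[of "h - g" n e cs] unfolding detect_def by (meson not_le_imp_less)
    \<comment> \<open>A hit on a truncated \<open>h - g = 0\<close> is impossible, since the target
      is at least 1. Hence \<open>g < h\<close>, and the doubled stride stays within its
      bound.\<close>
    moreover have "h - g > 0" using calculation first_err_cases[of n e] by auto
    ultimately show ?thesis using s True hg k by (auto simp: gallop_def Let_def intro: exI[of _ "Suc k"])
  next
    case False
    have "\<exists>k'. (g + 1) div 2 = 2 ^ k'"
      by (cases k) (auto simp: k half_pow2 intro: exI[of _ 0])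
    then show ?thesis using s False hg by (auto simp: gallop_def Let_def)
  qed
qed

lemma search_cong:
  assumes "length xs = (2 * m) * n" "l \<le> m"
  shows "search n e (coins (xs @ ys)) l = search n e (coins xs) l"
  using assms(2)
proof (induction l)
  case (Suc l)
  \<comment> \<open>Even from the upper end n + 1 the tested prefix has length at most
    \<open>n\<close>, because the stride is positive.\<close>
  have i: "fst (search n e (coins xs) l) \<le> n + 1" "snd (search n e (coins xs) l) \<ge> 1"
    using search_inv[of n e "coins xs" l] by auto
  have "detect n e (coins (xs @ ys)) (2 * l) q = detect n e (coins xs) (2 * l) q" if "q \<le> n" for q
    using psum_coins_take[OF assms(1), of "2 * l" q e ys] psum_coins_take[OF assms(1), of "Suc (2 * l)" q e ys]
      that Suc.prems by (simp add: detect_def)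
  then show ?case using Suc i by (simp add: Let_def)
qed simp

lemma expected_pot_gallop:
  fixes e :: "nat \<Rightarrow> 'a::ring_1"
  assumes h: "first_err n e \<le> h" "h \<le> n + 1" and g: "g = 2 ^ k"
  shows "(\<Sum>ys | length ys = 2 * n. let s = gallop (detect n e (coins ys) 0 (h - g)) (h, g) in
             pot (fst s - first_err n e) (snd s))
         \<le> 7/8 * 2 ^ (2 * n) * pot (h - first_err n e) g"
proof -
  define x where "x = first_err n e"
  define d where "d = h - x"
  let ?P = "pot d g"
  let ?Y = "{ys :: bool list. length ys = 2 * n}"
  let ?f = "\<lambda>ys. let s = gallop (detect n e (coins ys) 0 (h - g)) (h, g) in pot (fst s - x) (snd s)"
  have x1: "x \<ge> 1" using first_err_cases[of n e] by (auto simp: x_def)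
  have P: "?P \<ge> 0" by (rule pot_nonneg)
  have g0: "g > 0" using g by simp
  show ?thesis
  proof (cases "g \<le> d")
    case False
    \<comment> \<open>A stride beyond the distance reaches in front of the target, so the miss is
      certain as well as correct.\<close>
    have nd: "\<not> detect n e (coins ys) 0 (h - g)" for ys
    proof -
      have "h - g < x" using False x1 by (auto simp: d_def)
      then show ?thesis by (auto simp: detect_def x_def intro: psum_zero)
    qed
    have "?f ys \<le> 7/8 * ?P" for ys
    proof (cases "d = 0")
      case True
      then show ?thesis using nd h by (simp add: gallop_def pot_def d_def)
    next
      case d0: False
      then have "?f ys \<le> 1/2 * ?P"
        using nd pot_miss_far[of d k] False g by (simp add: gallop_def d_def)
      then show ?thesis using P by linarith
    qed
    then have "(\<Sum>ys\<in>?Y. ?f ys) \<le> (\<Sum>ys\<in>?Y. 7/8 * ?P)" by (intro sum_mono)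
    then show ?thesis by (simp add: card_bool_lists x_def d_def)
  next
    case True
    let ?B = "{ys. length ys = 2 * n \<and> \<not> detect n e (coins ys) 0 (h - g)}"
    \<comment> \<open>A hit leaves at most half of the potential, a miss at most 2 = 1/2 + 3/2 times
      as much. The excess 3/2 is charged to at most a quarter of the strings, which gives 1/2 + 3/8
      = 7/8.\<close>
    have fB: "?f ys \<le> 1/2 * ?P + (if \<not> detect n e (coins ys) 0 (h - g) then 3/2 * ?P else 0)" for ys
    proof (cases "detect n e (coins ys) 0 (h - g)")
      case t: True
      have "h - g - x = d - g" by (simp add: d_def)
      then show ?thesis using pot_hit[OF g0 True] t by (simp add: gallop_def)
    next
      case f: False
      have "d > 0" using True g0 by simp
      with f show ?thesis using pot_miss_near[of d k] True g by (simp add: gallop_def d_def)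
    qed
    have "x \<le> h - g" "h - g \<le> n" using True h g0 by (auto simp: d_def)
    then have c: "4 * card ?B \<le> 2 ^ (2 * n)" unfolding x_def by (rule card_not_detect)
    have c: "4 * real (card ?B) \<le> 2 ^ (2 * n)" using of_nat_mono[OF c, where 'a = real] by simp
    have "(\<Sum>ys\<in>?Y. ?f ys) \<le> (\<Sum>ys\<in>?Y. 1/2 * ?P + (if \<not> detect n e (coins ys) 0 (h - g) then 3/2 * ?P else 0))"
      using fB by (intro sum_mono)
    also have "\<dots> = 1/2 * ?P * 2 ^ (2 * n) + (\<Sum>ys\<in>?B. 3/2 * ?P)"
      by (simp add: sum.distrib card_bool_lists sum.inter_filter[symmetric])
    also have "\<dots> = 1/2 * ?P * 2 ^ (2 * n) + 3/8 * ?P * (4 * real (card ?B))" by simp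
    also have "\<dots> \<le> 1/2 * ?P * 2 ^ (2 * n) + 3/8 * ?P * 2 ^ (2 * n)"
      using P c by (intro add_left_mono mult_left_mono) auto
    finally show ?thesis by (simp add: x_def d_def mult_ac)
  qed
qed

text \<open>The state after \<open>m\<close> steps is fixed by the first \<open>2 * n * m\<close>
  coins, so the next step is averaged over fresh ones. The factor \<open>n ^ 5\<close> bounds the
  initial potential: stride 1 and distance at most \<open>n\<close>.\<close>

lemma expected_pot_search:
  fixes e :: "nat \<Rightarrow> 'a::ring_1"
  shows "(\<Sum>bs | length bs = 2 * n * m. pot (fst (search n e (coins bs) m) - first_err n e) (snd (search n e (coins bs) m)))
    \<le> (7/8) ^ m * 2 ^ (2 * n * m) * real n ^ 5"
proof (induction m)
  case 0
  have "pot (n + 1 - first_err n e) 1 \<le> real n ^ 5"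
  proof -
    have "n + 1 - first_err n e \<le> n" using first_err_cases[of n e] by auto
    then have "real (n + 1 - first_err n e) ^ 5 \<le> real n ^ 5" by (intro power_mono) linarith+
    then show ?thesis by (auto simp: pot_def)
  qed
  then show ?case by simp
next
  case (Suc m)
  define p where "p s = pot (fst s - first_err n e) (snd s)" for s
  have step: "search n e (coins (xs @ ys)) (Suc m) =
      gallop (detect n e (coins ys) 0 (fst (search n e (coins xs) m) - snd (search n e (coins xs) m))) (search n e (coins xs) m)"
    if "length xs = 2 * n * m" for xs ys
  proof -
    have l: "length xs = (2 * m) * n" using that by simp
    have "detect n e (coins (xs @ ys)) (2 * m) q = detect n e (coins ys) 0 q" for q
      using psum_coins_append[OF l, of e ys 0 q] psum_coins_append[OF l, of e ys 1 q] by (simp add: detect_def)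
    then show ?thesis using search_cong[OF l, of m e ys] by (simp add: Let_def)
  qed
  have "(\<Sum>bs | length bs = 2 * n * Suc m. p (search n e (coins bs) (Suc m))) =
      (\<Sum>xs | length xs = 2 * n * m. \<Sum>ys | length ys = 2 * n. p (search n e (coins (xs @ ys)) (Suc m)))"
    using sum_bool_lists_append[of "\<lambda>bs. p (search n e (coins bs) (Suc m))" "2 * n * m" "2 * n"]
    by (simp only: mult_Suc_right add.commute)
  also have "\<dots> \<le> (\<Sum>xs | length xs = 2 * n * m. 7/8 * 2 ^ (2 * n) * p (search n e (coins xs) m))"
  proof (rule sum_mono)
    fix xs :: "bool list" assume "xs \<in> {xs. length xs = 2 * n * m}"
    then have l: "length xs = 2 * n * m" by simp
    obtain h g where s: "search n e (coins xs) m = (h, g)" by fastforce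
    obtain k where k: "first_err n e \<le> h" "h \<le> n + 1" "g = 2 ^ k" using search_inv[of n e "coins xs" m] s by auto
    show "(\<Sum>ys | length ys = 2 * n. p (search n e (coins (xs @ ys)) (Suc m))) \<le> 7/8 * 2 ^ (2 * n) * p (search n e (coins xs) m)"
      unfolding step[OF l] s using expected_pot_gallop[OF k] by (simp add: p_def Let_def)
  qed
  also have "\<dots> = 7/8 * 2 ^ (2 * n) * (\<Sum>xs | length xs = 2 * n * m. p (search n e (coins xs) m))"
    by (simp add: sum_distrib_left)
  also have "\<dots> \<le> 7/8 * 2 ^ (2 * n) * ((7/8) ^ m * 2 ^ (2 * n * m) * real n ^ 5)"
    using Suc.IH unfolding p_def by (intro mult_left_mono) auto
  also have "\<dots> = (7/8) ^ Suc m * 2 ^ (2 * n * Suc m) * real n ^ 5"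
    by (simp add: power_add)
  finally show ?case unfolding p_def .
qed

text \<open>Markov's inequality for the potential, which is nonnegative everywhere and at least 1
  wherever the search is off its target.\<close>

lemma card_search_fail:
  fixes e :: "nat \<Rightarrow> 'a::ring_1"
  shows "real (card {bs. length bs = 2 * n * m \<and> fst (search n e (coins bs) m) \<noteq> first_err n e})
     \<le> (7/8) ^ m * 2 ^ (2 * n * m) * real n ^ 5"
proof -
  let ?p = "\<lambda>bs. pot (fst (search n e (coins bs) m) - first_err n e) (snd (search n e (coins bs) m))"
  let ?B = "{bs. length bs = 2 * n * m \<and> fst (search n e (coins bs) m) \<noteq> first_err n e}"
  have "real (card ?B) = (\<Sum>bs\<in>?B. 1)" by simp
  also have "\<dots> \<le> (\<Sum>bs\<in>?B. ?p bs)"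
  proof (rule sum_mono)
    fix bs assume "bs \<in> ?B"
    then show "1 \<le> ?p bs" using search_inv[of n e "coins bs" m] by (intro pot_ge_1) auto
  qed
  also have "\<dots> \<le> (\<Sum>bs | length bs = 2 * n * m. ?p bs)"
    by (rule sum_mono2) (auto intro: pot_nonneg)
  also note expected_pot_search
  finally show ?thesis .
qed

section \<open>One set of vectors for all searches: the union bound\<close>

definition tail :: "nat \<Rightarrow> (nat \<Rightarrow> 'a::zero) \<Rightarrow> nat \<Rightarrow> 'a" where
  "tail s e j = (if j < s then 0 else e j)"

text \<open>The only event about coins on which the correctness of a run depends. It speaks of the
  initial error matrix and not of the matrix under correction, so no adaptivity enters. The state
  \<open>s = n\<close> is the clean row, whose search has to end at \<open>n + 1\<close>.\<close>

definition good :: "nat \<Rightarrow> nat \<Rightarrow> (nat \<Rightarrow> nat \<Rightarrow> 'a::ring_1) \<Rightarrow> (nat \<Rightarrow> bool) \<Rightarrow> bool" where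
  "good n m E cs \<longleftrightarrow> (\<forall>i<n. \<forall>s\<le>n. fst (search n (tail s (E i)) cs m) = first_err n (tail s (E i)))"

text \<open>Union bound over \<open>n * (n + 1)\<close> states. The searches depend on the first
  \<open>2 * n * m\<close> coins only; the remaining coins of a string of length \<open>T\<close>
  are free and contribute a common power of 2.\<close>

lemma card_not_good:
  fixes E :: "nat \<Rightarrow> nat \<Rightarrow> 'a::ring_1"
  assumes "2 * n * m \<le> T"
  shows "real (card {bs. length bs = T \<and> \<not> good n m E (coins bs)}) \<le> real n * real (n + 1) * real n ^ 5 * (7/8) ^ m * 2 ^ T"
proof -
  define M where "M = 2 * n * m"
  let ?F = "\<lambda>i s. {bs. length bs = M \<and> fst (search n (tail s (E i)) (coins bs) m) \<noteq> first_err n (tail s (E i))}"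
  let ?G = "{bs. length bs = M \<and> \<not> good n m E (coins bs)}"
  have fin: "finite (?F i s)" for i s by (rule rev_finite_subset[OF finite_bool_lists[of M]]) auto
  have "?G \<subseteq> (\<Union>p\<in>{..<n} \<times> {..n}. ?F (fst p) (snd p))"
  proof
    fix bs assume "bs \<in> ?G"
    then obtain i s where "i < n" "s \<le> n" "bs \<in> ?F i s" unfolding good_def by blast
    then show "bs \<in> (\<Union>p\<in>{..<n} \<times> {..n}. ?F (fst p) (snd p))"
      by (intro UN_I[of "(i, s)"]) simp_all
  qed
  then have "card ?G \<le> card (\<Union>p\<in>{..<n} \<times> {..n}. ?F (fst p) (snd p))"
    using fin by (intro card_mono finite_UN_I) auto
  also have "\<dots> \<le> (\<Sum>p\<in>{..<n} \<times> {..n}. card (?F (fst p) (snd p)))"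
    by (rule card_UN_le) simp
  finally have "real (card ?G) \<le> (\<Sum>p\<in>{..<n} \<times> {..n}. real (card (?F (fst p) (snd p))))"
    unfolding of_nat_sum[symmetric] by (rule of_nat_mono)
  also have "\<dots> \<le> (\<Sum>p\<in>{..<n} \<times> {..n}. (7/8) ^ m * 2 ^ M * real n ^ 5)"
    unfolding M_def by (intro sum_mono card_search_fail)
  finally have G: "real (card ?G) \<le> real n * real (n + 1) * ((7/8) ^ m * 2 ^ M * real n ^ 5)"
    by (simp add: algebra_simps)
  have good: "good n m E (coins (xs @ ys)) = good n m E (coins xs)" if "length xs = M" for xs ys
    using that by (simp add: good_def M_def search_cong[of xs m n m])
  have "{bs. length bs = T \<and> \<not> good n m E (coins bs)} \<subseteq> (\<lambda>(xs, ys). xs @ ys) ` (?G \<times> {ys. length ys = T - M})"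
  proof
    fix bs assume b: "bs \<in> {bs. length bs = T \<and> \<not> good n m E (coins bs)}"
    then have l: "length (take M bs) = M" using assms by (simp add: M_def)
    show "bs \<in> (\<lambda>(xs, ys). xs @ ys) ` (?G \<times> {ys. length ys = T - M})"
      using good[OF l, of "drop M bs"] b l by (intro image_eqI[of _ _ "(take M bs, drop M bs)"]) auto
  qed
  then have "card {bs. length bs = T \<and> \<not> good n m E (coins bs)} \<le> card (?G \<times> {ys :: bool list. length ys = T - M})"
    by (rule surj_card_le[rotated]) (auto intro: rev_finite_subset[OF finite_bool_lists[of M]])
  then have "real (card {bs. length bs = T \<and> \<not> good n m E (coins bs)}) \<le> real (card ?G * 2 ^ (T - M))"
    unfolding card_cartesian_product card_bool_lists by (rule of_nat_mono)
  also have "\<dots> = real (card ?G) * 2 ^ (T - M)" by simp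
  also have "\<dots> \<le> real n * real (n + 1) * ((7/8) ^ m * 2 ^ M * real n ^ 5) * 2 ^ (T - M)"
    by (intro mult_right_mono G) auto
  also have "\<dots> = real n * real (n + 1) * real n ^ 5 * (7/8) ^ m * (2 ^ M * 2 ^ (T - M))" by simp
  also have "2 ^ M * 2 ^ (T - M) = (2 ^ T :: real)"
    using assms by (simp add: M_def flip: power_add)
  finally show ?thesis .
qed

lemma ex_SeqI:
  assumes "ex W cs c ba Q' N R k" "\<And>N R k. Q' N R k \<Longrightarrow> ex W cs d bc Q N R k" "ba + bc \<le> b"
  shows "ex W cs (c ;; d) b Q N R k"
  by (rule ex_Seq[where ba = ba and bc = bc]) (use assms in \<open>auto intro: ex_mono\<close>)

section \<open>Testing and searching on the machine\<close>

text \<open>Register 0 holds \<open>n\<close>; 2--16 are constant after the setup (see \<open>regs\<close> below), the others are working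
  registers.  Ring memory beyond the input: four scratch cells at \<open>3n\<^sup>2\<close>, then \<open>2 M\<close> random 0/1 vectors \<open>V\<close>,
  then the rows \<open>S u\<close> of the prefix table.\<close>

abbreviation (input) "rZ \<equiv> 2 :: nat"
abbreviation (input) "rONE \<equiv> 3 :: nat"
abbreviation (input) "rTWO \<equiv> 4 :: nat"
abbreviation (input) "rNN \<equiv> 5 :: nat"
abbreviation (input) "rM \<equiv> 6 :: nat"
abbreviation (input) "rM2 \<equiv> 7 :: nat"
abbreviation (input) "rCB \<equiv> 8 :: nat"
abbreviation (input) "rX1 \<equiv> 9 :: nat"
abbreviation (input) "rX2 \<equiv> 10 :: nat"
abbreviation (input) "rX3 \<equiv> 11 :: nat"
abbreviation (input) "rTMP \<equiv> 12 :: nat"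
abbreviation (input) "rVB \<equiv> 13 :: nat"
abbreviation (input) "rVS \<equiv> 14 :: nat"
abbreviation (input) "rSB \<equiv> 15 :: nat"
abbreviation (input) "rN1 \<equiv> 16 :: nat"
abbreviation (input) "rACC \<equiv> 20 :: nat"
abbreviation (input) "rPA \<equiv> 21 :: nat"
abbreviation (input) "rPB \<equiv> 22 :: nat"
abbreviation (input) "rST \<equiv> 23 :: nat"
abbreviation (input) "rLEN \<equiv> 24 :: nat"
abbreviation (input) "rCNT \<equiv> 25 :: nat"
abbreviation (input) "rI \<equiv> 26 :: nat"
abbreviation (input) "rJ \<equiv> 27 :: nat"
abbreviation (input) "rT \<equiv> 28 :: nat"
abbreviation (input) "rQ \<equiv> 29 :: nat"
abbreviation (input) "rFL \<equiv> 30 :: nat"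
abbreviation (input) "rHI \<equiv> 31 :: nat"
abbreviation (input) "rG \<equiv> 32 :: nat"
abbreviation (input) "rF \<equiv> 33 :: nat"
abbreviation (input) "rU \<equiv> 34 :: nat"
abbreviation (input) "rL \<equiv> 35 :: nat"
abbreviation (input) "rAUX \<equiv> 36 :: nat"
abbreviation (input) "rDST \<equiv> 37 :: nat"
abbreviation (input) "rLG \<equiv> 38 :: nat"
abbreviation (input) "rPW \<equiv> 39 :: nat"
abbreviation (input) "rVA \<equiv> 40 :: nat"

text \<open>The first operand is always contiguous, the second has a stride: 1 for table rows and
  random vectors, \<open>n\<close> for a column of \<open>B\<close>. \<open>rACC\<close> and
  \<open>rTMP\<close> point to scratch cells of the ring memory.\<close>

definition dot_com :: com where
  "dot_com =
     Block [RZero rACC, NConst rCNT 0] ;;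
     While (CLess rCNT rLEN)
       (Block [RMul rTMP rPA rPB, RAdd rACC rACC rTMP, NAdd rPA rPA rONE, NAdd rPB rPB rST, NAdd rCNT rCNT rONE])"

lemma ex_dot:
  fixes R :: "nat \<Rightarrow> 'a::ring_1"
  assumes one: "N rONE = 1" and x: "N rACC = x" "N rTMP = y" "x \<noteq> y" and L: "N rLEN = L"
    and a: "N rPA = a" "N rPB = b" "N rST = s"
    and dis: "\<And>l. l < L \<Longrightarrow> a + l \<noteq> x \<and> a + l \<noteq> y \<and> b + l * s \<noteq> x \<and> b + l * s \<noteq> y"
    and W: "a + L < W" "b + L * s < W" "L < W"
    and bb: "7 * L + 4 \<le> bb"
  shows "ex W cs dot_com bb (\<lambda>N' R' k'. k' = k \<and> (\<forall>r. r \<notin> {rPA, rPB, rCNT} \<longrightarrow> N' r = N r) \<and>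
     R' x = (\<Sum>l<L. R (a + l) * R (b + l * s)) \<and> (\<forall>z. z \<noteq> x \<and> z \<noteq> y \<longrightarrow> R' z = R z)) N R k"
  unfolding dot_com_def
proof (rule ex_Block_Seq[where bc = "7 * L + 2"])
  define I where "I = (\<lambda>l N' R' k'. k' = k \<and> N' rCNT = l \<and> N' rPA = a + l \<and> N' rPB = b + l * s \<and>
     (\<forall>r. r \<notin> {rPA, rPB, rCNT} \<longrightarrow> N' r = N r) \<and>
     R' x = (\<Sum>l<l. R (a + l) * R (b + l * s)) \<and> (\<forall>z. z \<noteq> x \<and> z \<noteq> y \<longrightarrow> R' z = R z))"
  have "ex W cs (While (CLess rCNT rLEN)
       (Block [RMul rTMP rPA rPB, RAdd rACC rACC rTMP, NAdd rPA rPA rONE, NAdd rPB rPB rST, NAdd rCNT rCNT rONE]))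
       (7 * L + 2) (\<lambda>N' R' k'. k' = k \<and> (\<forall>r. r \<notin> {rPA, rPB, rCNT} \<longrightarrow> N' r = N r) \<and>
     R' x = (\<Sum>l<L. R (a + l) * R (b + l * s)) \<and> (\<forall>z. z \<noteq> x \<and> z \<noteq> y \<longrightarrow> R' z = R z))
     (N(rCNT := 0)) (R(x := 0)) k"
  proof (rule ex_While_const[where I = I and J = L and T = 5])
    show "I 0 (N(rCNT := 0)) (R(x := 0)) k" using a by (simp add: I_def)
  next
    fix l N' R' k' assume l: "l < L" and I: "I l N' R' k'"
    have B: "a + l < W" "b + l * s + s < W" "Suc (a + l) < W" "Suc l < W"
    proof -
      have "b + l * s + s \<le> b + L * s" using mult_le_mono1[of "Suc l" L s] l by simp
      then show "b + l * s + s < W" using W by simp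
    qed (use l W in auto)
    have d: "a + l \<noteq> x" "a + l \<noteq> y" "b + l * s \<noteq> x" "b + l * s \<noteq> y" using dis[OF l] by auto
    have v: "N' rACC = x" "N' rTMP = y" "N' rLEN = L" "N' rST = s" "N' rONE = 1" "N' rCNT = l" "N' rPA = a + l"
       "N' rPB = b + l * s"
      using I x L one a by (auto simp: I_def)
    have f: "N' r = N r" if "r \<noteq> rPA" "r \<noteq> rPB" "r \<noteq> rCNT" for r using I that by (simp add: I_def)
    have g: "R' z = R z" if "z \<noteq> x" "z \<noteq> y" for z using I that by (simp add: I_def)
    have Rx: "R' x = (\<Sum>l<l. R (a + l) * R (b + l * s))" "k' = k" using I by (auto simp: I_def)
    show "cval (CLess rCNT rLEN) N' R' \<and> ex W cs (Block [RMul rTMP rPA rPB, RAdd rACC rACC rTMP, NAdd rPA rPA rONE, NAdd rPB rPB rST, NAdd rCNT rCNT rONE]) 5 (I (Suc l)) N' R' k'"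
    proof (intro conjI ex_Block)
      show "wpb W cs [RMul rTMP rPA rPB, RAdd rACC rACC rTMP, NAdd rPA rPA rONE, NAdd rPB rPB rST, NAdd rCNT rCNT rONE] (I (Suc l)) N' R' k'"
        using v B d x(3) by (simp add: I_def f g Rx x a L one)
    qed (use v l in auto)
  next
    fix N' R' k' assume "I L N' R' k'"
    then show "\<not> cval (CLess rCNT rLEN) N' R' \<and> k' = k \<and> (\<forall>r. r \<notin> {rPA, rPB, rCNT} \<longrightarrow> N' r = N r) \<and>
     R' x = (\<Sum>l<L. R (a + l) * R (b + l * s)) \<and> (\<forall>z. z \<noteq> x \<and> z \<noteq> y \<longrightarrow> R' z = R z)"
      using L by (simp add: I_def)
  qed simp
  then show "wpb W cs [RZero rACC, NConst rCNT 0]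
     (ex W cs (While (CLess rCNT rLEN)
       (Block [RMul rTMP rPA rPB, RAdd rACC rACC rTMP, NAdd rPA rPA rONE, NAdd rPB rPB rST, NAdd rCNT rCNT rONE]))
       (7 * L + 2) (\<lambda>N' R' k'. k' = k \<and> (\<forall>r. r \<notin> {rPA, rPB, rCNT} \<longrightarrow> N' r = N r) \<and>
     R' x = (\<Sum>l<L. R (a + l) * R (b + l * s)) \<and> (\<forall>z. z \<noteq> x \<and> z \<noteq> y \<longrightarrow> R' z = R z))) N R k"
    using x W by simp
qed (use bb in simp)

text \<open>The coin sequence is fixed as well, so everything proved inside concerns a deterministic
  run. \<open>W_large\<close> makes room for the input, the scratch cells, the vectors and
  \<open>2 * M * n + 1\<close> table rows of length \<open>n\<close>, with some slack for pointers
  that run past the end.\<close>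

locale correction =
  fixes n M W :: nat and A B C :: "nat \<Rightarrow> nat \<Rightarrow> 'a::ring_1" and cs :: "nat \<Rightarrow> bool"
  assumes n_pos: "n \<ge> 1" and W_large: "2 * M * n * n + 2 * M * n + 5 * (n * n) + 5 * n + 20 < W"
begin

definition regs :: "(nat \<Rightarrow> nat) \<Rightarrow> bool" where
  "regs N \<longleftrightarrow> N 0 = n \<and> N rZ = 0 \<and> N rONE = 1 \<and> N rTWO = 2 \<and> N rNN = n * n \<and> N rM = M \<and> N rM2 = 2 * M \<and>
     N rCB = 2 * (n * n) \<and> N rX1 = 3 * (n * n) \<and> N rX2 = 3 * (n * n) + 1 \<and> N rX3 = 3 * (n * n) + 2 \<and>
     N rTMP = 3 * (n * n) + 3 \<and> N rVB = 3 * (n * n) + 4 \<and> N rVS = 2 * M * n \<and>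
     N rSB = 3 * (n * n) + 4 + 2 * M * n \<and> N rN1 = n + 1"

definition memAB :: "(nat \<Rightarrow> 'a) \<Rightarrow> bool" where
  "memAB R \<longleftrightarrow> (\<forall>i<n. \<forall>j<n. R (i * n + j) = A i j \<and> R (n * n + i * n + j) = B i j)"

definition memC :: "(nat \<Rightarrow> nat \<Rightarrow> 'a) \<Rightarrow> (nat \<Rightarrow> 'a) \<Rightarrow> bool" where
  "memC D R \<longleftrightarrow> (\<forall>i<n. \<forall>j<n. R (2 * (n * n) + i * n + j) = D i j)"

definition V :: "nat \<Rightarrow> 'a" where
  "V u = (if cs u then 1 else 0)"

text \<open>The prefix sums run across the borders of the vectors; those of the \<open>t\<close>-th vector are the
  differences \<open>S (t * n + q) l - S (t * n) l\<close>.\<close>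

definition S :: "nat \<Rightarrow> nat \<Rightarrow> 'a" where
  "S u l = (\<Sum>u'<u. B l (u' mod n) * V u')"

definition tab :: "nat \<Rightarrow> (nat \<Rightarrow> 'a) \<Rightarrow> bool" where
  "tab w R \<longleftrightarrow> (\<forall>u<w. R (3 * (n * n) + 4 + u) = V u) \<and>
     (\<forall>u\<le>w. \<forall>l<n. R (3 * (n * n) + 4 + 2 * M * n + u * n + l) = S u l)"

definition same :: "(nat \<Rightarrow> 'a) \<Rightarrow> (nat \<Rightarrow> 'a) \<Rightarrow> bool" where
  "same R R' \<longleftrightarrow> (\<forall>z. z < 3 * (n * n) \<or> 3 * (n * n) + 4 \<le> z \<longrightarrow> R' z = R z)"

lemma W_lin: "5 * n + 20 < W"
  using W_large by linarith

lemma same_trans: "same R R' \<Longrightarrow> same R' R'' \<Longrightarrow> same R R''"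
  by (simp add: same_def)

lemma idx: "i < n \<Longrightarrow> j < n \<Longrightarrow> i * n + j < n * n"
proof -
  assume "i < n" "j < n"
  then have "i * n + j < Suc i * n" by simp
  also have "\<dots> \<le> n * n" using \<open>i < n\<close> by (intro mult_le_mono1) simp
  finally show ?thesis .
qed

lemma idx_end: "i < n \<Longrightarrow> i * n + n \<le> n * n"
  using mult_le_mono1[of "Suc i" n n] by simp

lemma same_memAB: "same R R' \<Longrightarrow> memAB R \<Longrightarrow> memAB R'"
  unfolding memAB_def
proof (intro allI impI)
  fix i j assume s: "same R R'" and m: "\<forall>i<n. \<forall>j<n. R (i * n + j) = A i j \<and> R (n * n + i * n + j) = B i j"
    and ij: "i < n" "j < n"
  have "i * n + j < 3 * (n * n)" "n * n + i * n + j < 3 * (n * n)" using idx[OF ij] by linarith+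
  then show "R' (i * n + j) = A i j \<and> R' (n * n + i * n + j) = B i j" using s m ij by (simp add: same_def)
qed

lemma same_memC: "same R R' \<Longrightarrow> memC D R \<Longrightarrow> memC D R'"
  unfolding memC_def
proof (intro allI impI)
  fix i j assume s: "same R R'" and m: "\<forall>i<n. \<forall>j<n. R (2 * (n * n) + i * n + j) = D i j"
    and ij: "i < n" "j < n"
  have "2 * (n * n) + i * n + j < 3 * (n * n)" using idx[OF ij] by linarith+
  then show "R' (2 * (n * n) + i * n + j) = D i j" using s m ij by (simp add: same_def)
qed

lemma same_tab: "same R R' \<Longrightarrow> tab w R \<Longrightarrow> tab w R'"
  by (simp add: same_def tab_def)

text \<open>Freivalds' observation that A (B v) = (A B) v, for prefixes of a random vector and read
  off from two table rows. Within one vector the index \<open>t * n + j\<close> has remainder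
  \<open>j\<close> modulo \<open>n\<close>, so the right columns of \<open>B\<close> are
  summed.\<close>

lemma sum_A_S:
  assumes "q \<le> n"
  shows "(\<Sum>l<n. A i l * S (t * n + q) l) =
    (\<Sum>l<n. A i l * S (t * n) l) + (\<Sum>j<q. if cs (t * n + j) then mat_mult n A B i j else 0)"
proof -
  have S: "S (t * n + q) l = S (t * n) l + (\<Sum>j<q. B l j * V (t * n + j))" for l
  proof -
    have "S (t * n + q) l = S (t * n) l + (\<Sum>j<q. B l ((t * n + j) mod n) * V (t * n + j))"
      unfolding S_def by (induction q) (auto simp: algebra_simps)
    also have "(\<Sum>j<q. B l ((t * n + j) mod n) * V (t * n + j)) = (\<Sum>j<q. B l j * V (t * n + j))"
      using assms by (intro sum.cong) auto
    finally show ?thesis .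
  qed
  have "(\<Sum>l<n. A i l * (\<Sum>j<q. B l j * V (t * n + j))) = (\<Sum>l<n. \<Sum>j<q. A i l * B l j * V (t * n + j))"
    by (simp add: sum_distrib_left mult.assoc)
  also have "\<dots> = (\<Sum>j<q. \<Sum>l<n. A i l * B l j * V (t * n + j))" by (rule sum.swap)
  also have "\<dots> = (\<Sum>j<q. mat_mult n A B i j * V (t * n + j))"
    by (simp add: mat_mult_def sum_distrib_right)
  also have "\<dots> = (\<Sum>j<q. if cs (t * n + j) then mat_mult n A B i j else 0)"
    by (intro sum.cong) (auto simp: V_def)
  finally show ?thesis by (simp add: S distrib_left sum.distrib)
qed

text \<open>The comparison as the machine makes it: three dot products and an equality test, with
  the subtrahends moved to the other side.\<close>

lemma test_iff:
  assumes "q \<le> n"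
  shows "(\<Sum>l<n. A i l * S (t * n + q) l) = (\<Sum>l<n. A i l * S (t * n) l) + (\<Sum>j<q. D j * V (t * n + j))
    \<longleftrightarrow> psum n (\<lambda>j. mat_mult n A B i j - D j) cs t q = 0"
proof -
  have "psum n (\<lambda>j. mat_mult n A B i j - D j) cs t q =
     (\<Sum>j<q. (if cs (t * n + j) then mat_mult n A B i j else 0) - D j * V (t * n + j))"
    unfolding psum_def by (intro sum.cong) (auto simp: V_def)
  then show ?thesis unfolding sum_A_S[OF assms] by (simp add: sum_subtractf)
qed

end

text \<open>The flag is only ever raised and \<open>rT\<close> advances, so two calls in a row
  evaluate the disjunction in \<open>detect\<close>.\<close>

definition test_com :: com where
  "test_com =
     (Block [NMul rPA rI 0, NMul rAUX rT 0, NAdd rPB rAUX rQ, NMul rPB rPB 0, NAdd rPB rPB rSB,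
        NConst rST 1, NAdd rLEN 0 rZ, NAdd rACC rX1 rZ] ;; dot_com) ;;
     (Block [NMul rPA rI 0, NMul rAUX rT 0, NMul rPB rAUX 0, NAdd rPB rPB rSB,
        NConst rST 1, NAdd rLEN 0 rZ, NAdd rACC rX2 rZ] ;; dot_com) ;;
     (Block [NMul rPA rI 0, NAdd rPA rPA rCB, NMul rAUX rT 0, NAdd rPB rAUX rVB,
        NConst rST 1, NAdd rLEN rQ rZ, NAdd rACC rX3 rZ] ;; dot_com) ;;
     Block [RAdd rX2 rX2 rX3] ;;
     Cond (CEqR rX1 rX2) (Block []) (Block [NConst rFL 1]) ;;
     Block [NAdd rT rT rONE]"

context correction
begin

abbreviation "dotregs \<equiv> {rPA, rPB, rCNT, rST, rLEN, rACC, rAUX}"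

lemma regs_frame:
  assumes "regs N" "\<And>r. r \<le> 16 \<Longrightarrow> N' r = N r" shows "regs N'"
  using assms by (simp add: regs_def)

lemma ex_test:
  assumes N: "regs N" and R: "memAB R" "memC D R" "tab (2 * M * n) R"
    and i: "N rI = i" "i < n" and t: "N rT = t" "t < 2 * M" and q: "N rQ = q" "q \<le> n"
  shows "ex W cs test_com (21 * n + 50) (\<lambda>N' R' k'. k' = k \<and> (\<forall>r. r \<notin> dotregs \<union> {rFL, rT} \<longrightarrow> N' r = N r) \<and>
    N' rT = Suc t \<and> N' rFL = (if psum n (\<lambda>j. mat_mult n A B i j - D i j) cs t q \<noteq> 0 then 1 else N rFL) \<and> same R R') N R k"
proof -
  have tq: "t * n + q \<le> 2 * M * n"
  proof -
    have "t * n + q \<le> Suc t * n" using q by simp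
    also have "\<dots> \<le> 2 * M * n" using t by (intro mult_le_mono1) simp
    finally show ?thesis .
  qed
  have tqn: "(t * n + q) * n \<le> 2 * M * n * n" using mult_le_mono1[OF tq] .
  have tn: "t * n * n \<le> 2 * M * n * n" using mult_le_mono1[of "t * n" "2 * M * n" n] tq by (metis add_leD1)
  note ii = idx_end[OF i(2)]
  note bds = tq tqn tn ii W_large q(2)
  have wb: "(t * n + q) * n < W" "(t * n + q) * n + (3 * (n * n) + 4 + 2 * M * n) < W"
      "t * n * n < W" "t * n * n + (3 * (n * n) + 4 + 2 * M * n) < W" "t * n + q < W" "t * n < W"
      "i * n < W" "i * n + 2 * (n * n) < W" "t * n + (3 * (n * n) + 4) < W" "n < W" "q < W" "1 < W"
      "3 * (n * n) < W" "3 * (n * n) + 2 < W"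
    using bds by linarith+
  have A: "R (i * n + l) = A i l" if "l < n" for l using R i that by (simp add: memAB_def)
  have C: "R (2 * (n * n) + i * n + l) = D i l" if "l < n" for l using R i that by (simp add: memC_def)
  have ST: "R (3 * (n * n) + 4 + 2 * M * n + u * n + l) = S u l" if "l < n" "u \<le> 2 * M * n" for l u
    using R that by (simp add: tab_def)
  have VT: "R (3 * (n * n) + 4 + u) = V u" if "u < 2 * M * n" for u using R that by (simp add: tab_def)
  let ?X = "3 * (n * n)"
  have D1: "ex W cs (Block [NMul rPA rI 0, NMul rAUX rT 0, NAdd rPB rAUX rQ, NMul rPB rPB 0, NAdd rPB rPB rSB,
        NConst rST 1, NAdd rLEN 0 rZ, NAdd rACC rX1 rZ] ;; dot_com) (7 * n + 12)
     (\<lambda>N' R' k'. k' = k \<and> (\<forall>r. r \<notin> dotregs \<longrightarrow> N' r = N r) \<and> R' ?X = (\<Sum>l<n. A i l * S (t * n + q) l) \<and>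
        same R R') N R k"
    apply (rule ex_Block_Seq[where bc = "7 * n + 4"])
     apply simp
     apply (intro conjI)
             prefer 9
             apply (rule ex_mono[OF ex_dot[where L = n and x = ?X and y = "?X + 3" and a = "i * n"
             and b = "?X + 4 + 2 * M * n + (t * n + q) * n" and s = 1] order_refl])
    subgoal using N by (simp add: regs_def)
    subgoal using N by (simp add: regs_def)
    subgoal using N by (simp add: regs_def)
    subgoal by simp
    subgoal using N by (simp add: regs_def)
    subgoal using N i by (simp add: regs_def)
    subgoal using N t q by (simp add: regs_def)
    subgoal by simp
    subgoal using bds by linarith
    subgoal using bds by linarith
    subgoal using bds by linarith
    subgoal using bds by linarith
    subgoal by simp
    subgoal using tq by (auto simp: same_def A ST)
    using N i t q wb apply (simp_all add: regs_def)
    done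
  have D2: "ex W cs (Block [NMul rPA rI 0, NMul rAUX rT 0, NMul rPB rAUX 0, NAdd rPB rPB rSB,
        NConst rST 1, NAdd rLEN 0 rZ, NAdd rACC rX2 rZ] ;; dot_com) (7 * n + 12)
     (\<lambda>N' R' k'. k' = k \<and> (\<forall>r. r \<notin> dotregs \<longrightarrow> N' r = N r) \<and> R' (?X + 1) = (\<Sum>l<n. A i l * S (t * n) l) \<and>
        R' ?X = R1 ?X \<and> same R R') N1 R1 k"
    if N1: "\<forall>r. r \<notin> dotregs \<longrightarrow> N1 r = N r" and R1: "same R R1" for N1 R1
  proof -
    have regs1: "regs N1" by (rule regs_frame[OF N]) (use N1 in auto)
    have v1: "N1 rI = i" "N1 rT = t" using N1 i t by auto
    have A1: "R1 (i * n + l) = A i l" if "l < n" for l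
      using A[OF that] R1 ii that by (simp add: same_def)
    have S1: "R1 (?X + 4 + 2 * M * n + t * n * n + l) = S (t * n) l" if "l < n" for l
      using ST[of l "t * n"] that tq R1 t by (simp add: same_def)
    show ?thesis
      apply (rule ex_Block_Seq[where bc = "7 * n + 4"])
       apply simp
       apply (intro conjI)
              prefer 8
              apply (rule ex_mono[OF ex_dot[where L = n and x = "?X + 1" and y = "?X + 3" and a = "i * n"
             and b = "?X + 4 + 2 * M * n + t * n * n" and s = 1] order_refl])
      subgoal using regs1 by (simp add: regs_def)
      subgoal using regs1 by (simp add: regs_def)
      subgoal using regs1 by (simp add: regs_def)
      subgoal by simp
      subgoal using regs1 by (simp add: regs_def)
      subgoal using regs1 v1 by (simp add: regs_def)
      subgoal using regs1 v1 by (simp add: regs_def)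
      subgoal by simp
      subgoal using bds by linarith
      subgoal using bds by linarith
      subgoal using bds by linarith
      subgoal using bds by linarith
      subgoal by simp
      subgoal using R1 N1 by (auto simp: same_def A1 S1)
      using regs1 v1 wb apply (simp_all add: regs_def)
      done
  qed
  have D3: "ex W cs (Block [NMul rPA rI 0, NAdd rPA rPA rCB, NMul rAUX rT 0, NAdd rPB rAUX rVB,
        NConst rST 1, NAdd rLEN rQ rZ, NAdd rACC rX3 rZ] ;; dot_com) (7 * n + 12)
     (\<lambda>N' R' k'. k' = k \<and> (\<forall>r. r \<notin> dotregs \<longrightarrow> N' r = N r) \<and> R' (?X + 2) = (\<Sum>j<q. D i j * V (t * n + j)) \<and>
        R' ?X = R1 ?X \<and> R' (?X + 1) = R1 (?X + 1) \<and> same R R') N1 R1 k"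
    if N1: "\<forall>r. r \<notin> dotregs \<longrightarrow> N1 r = N r" and R1: "same R R1" for N1 R1
  proof -
    have regs1: "regs N1" by (rule regs_frame[OF N]) (use N1 in auto)
    have v1: "N1 rI = i" "N1 rT = t" "N1 rQ = q" using N1 i t q by auto
    have A1: "R1 (i * n + 2 * (n * n) + l) = D i l" if "l < q" for l
      using C[of l] R1 ii that q by (simp add: same_def algebra_simps)
    have S1: "R1 (?X + 4 + t * n + l) = V (t * n + l)" if "l < q" for l
      using VT[of "t * n + l"] that tq R1 by (simp add: same_def algebra_simps)
    show ?thesis
      apply (rule ex_Block_Seq[where bc = "7 * n + 4"])
       apply simp
       apply (intro conjI)
              prefer 8
              apply (rule ex_mono[OF ex_dot[where L = q and x = "?X + 2" and y = "?X + 3" and a = "i * n + 2 * (n * n)"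
             and b = "?X + 4 + t * n" and s = 1] order_refl])
      subgoal using regs1 by (simp add: regs_def)
      subgoal using regs1 by (simp add: regs_def)
      subgoal using regs1 by (simp add: regs_def)
      subgoal by simp
      subgoal using regs1 v1 by (simp add: regs_def)
      subgoal using regs1 v1 by (simp add: regs_def)
      subgoal using regs1 v1 by (simp add: regs_def)
      subgoal by simp
      subgoal using bds by linarith
      subgoal using bds by linarith
      subgoal using bds by linarith
      subgoal using bds by linarith
      subgoal using q by simp
      subgoal using R1 N1 by (auto simp: same_def A1 S1)
      using regs1 v1 wb apply (simp_all add: regs_def)
      done
  qed
  have D4: "ex W cs (Block [RAdd rX2 rX2 rX3] ;; Cond (CEqR rX1 rX2) (Block []) (Block [NConst rFL 1]) ;; Block [NAdd rT rT rONE]) 8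
     (\<lambda>N' R' k'. k' = k \<and> (\<forall>r. r \<notin> dotregs \<union> {rFL, rT} \<longrightarrow> N' r = N r) \<and>
    N' rT = Suc t \<and> N' rFL = (if psum n (\<lambda>j. mat_mult n A B i j - D i j) cs t q \<noteq> 0 then 1 else N rFL) \<and> same R R') N1 R1 k"
    if N1: "\<forall>r. r \<notin> dotregs \<longrightarrow> N1 r = N r" and R1: "same R R1" "R1 ?X = (\<Sum>l<n. A i l * S (t * n + q) l)"
      "R1 (?X + 1) = (\<Sum>l<n. A i l * S (t * n) l)" "R1 (?X + 2) = (\<Sum>j<q. D i j * V (t * n + j))" for N1 R1
  proof -
    have regs1: "N1 rX1 = ?X" "N1 rX2 = ?X + 1" "N1 rX3 = ?X + 2" "N1 rONE = 1" "N1 rT = t" "N1 rFL = N rFL"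
      using N N1 t by (auto simp: regs_def)
    note ti = test_iff[OF q(2), of i t "D i"]
    have b: "Suc t < W" "1 < W" using n_pos t W_large mult_le_mono2[OF n_pos, of "2 * M"] by linarith+
    define R2 where "R2 = R1(?X + 1 := R1 (?X + 1) + R1 (?X + 2))"
    have R2: "same R R2" "R2 ?X = R2 (?X + 1) \<longleftrightarrow> psum n (\<lambda>j. mat_mult n A B i j - D i j) cs t q = 0"
      using R1 ti by (auto simp: R2_def same_def)
    show ?thesis
      apply (rule ex_Block_Seq[where bc = 7])
       apply (simp only: wpb.simps regs1 R2_def[symmetric])
       apply (rule ex_SeqI[where ba = 3 and bc = 1 and Q' = "\<lambda>N' R' k'. k' = k \<and> R' = R2 \<and>
           N' = N1(rFL := (if psum n (\<lambda>j. mat_mult n A B i j - D i j) cs t q \<noteq> 0 then 1 else N rFL))"])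
         apply (rule ex_Cond[where ba = 0 and bc = 1])
            apply (rule ex_Block)
             apply (use R2 regs1 in \<open>simp add: fun_upd_idem\<close>)
            apply simp
           apply (rule ex_Block)
            apply (use R2 regs1 b in \<open>simp\<close>)
           apply simp
          apply simp
         apply simp
        apply (rule ex_Block)
         apply (use R2 regs1 b N1 in \<open>simp\<close>)
        apply simp
       apply simp
      apply simp
      done
  qed
  show ?thesis unfolding test_com_def
  proof (rule ex_SeqI[where bc = "14 * n + 38", OF D1], goal_cases)
    case (1 N1 R1 k1)
    then have k1: "k1 = k" by simp
    note one = 1
    show ?case unfolding k1
    proof (rule ex_SeqI[where bc = "7 * n + 24", OF D2], goal_cases)
      case (3 N2 R2 k2)
      then have k2: "k2 = k" by simp
      note two = 3
      show ?case unfolding k2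
      proof (rule ex_SeqI[where bc = 8, OF D3], goal_cases)
        case (3 N3 R3 k3)
        then have k3: "k3 = k" by simp
        show ?case unfolding k3
          by (rule D4) (use one two 3 in auto)
      qed (use two in auto)
    qed (use one in auto)
  qed simp
qed

end

definition search_com :: com where
  "search_com =
     Block [NAdd rHI rN1 rZ, NConst rG 1, NConst rT 0] ;;
     While (CLess rT rM2)
       (Block [NSub rQ rHI rG, NConst rFL 0] ;; test_com ;; test_com ;;
        Cond (CEqN rFL rONE)
          (Block [NAdd rHI rQ rZ, NAdd rG rG rG])
          (Block [NAdd rG rG rONE, NDiv rG rG rTWO]))"

context correction
begin

abbreviation "searchregs \<equiv> dotregs \<union> {rFL, rT, rQ, rHI, rG}"

lemma ex_search:
  assumes N: "regs N" and R: "memAB R" "memC D R" "tab (2 * M * n) R"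
    and i: "N rI = i" "i < n" and b: "M * (42 * n + 120) + 5 \<le> b"
  shows "ex W cs search_com b (\<lambda>N' R' k'. k' = k \<and> (\<forall>r. r \<notin> searchregs \<longrightarrow> N' r = N r) \<and>
    N' rHI = fst (search n (\<lambda>j. mat_mult n A B i j - D i j) cs M) \<and> same R R') N R k"
  unfolding search_com_def
proof (rule ex_Block_Seq[where bc = "M * (42 * n + 120) + 2"])
  let ?e = "\<lambda>j. mat_mult n A B i j - D i j"
  let ?Q = "\<lambda>N' R' k'. k' = k \<and> (\<forall>r. r \<notin> searchregs \<longrightarrow> N' r = N r) \<and>
    N' rHI = fst (search n ?e cs M) \<and> same R R'"
  let ?c = "Block [NSub rQ rHI rG, NConst rFL 0] ;; test_com ;; test_com ;;
        Cond (CEqN rFL rONE)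
          (Block [NAdd rHI rQ rZ, NAdd rG rG rG])
          (Block [NAdd rG rG rONE, NDiv rG rG rTWO])"
  define I where "I = (\<lambda>m N' R' k'. k' = k \<and> (\<forall>r. r \<notin> searchregs \<longrightarrow> N' r = N r) \<and>
    N' rT = 2 * m \<and> (N' rHI, N' rG) = search n ?e cs m \<and> same R R')"
  have "ex W cs (While (CLess rT rM2) ?c) (M * (42 * n + 120) + 2) ?Q
     (N(rHI := n + 1, rG := 1, rT := 0)) R k"
  proof (rule ex_While_const[where I = I and J = M and T = "42 * n + 118"])
    show "I 0 (N(rHI := n + 1, rG := 1, rT := 0)) R k" by (simp add: I_def same_def)
  next
    fix m N1 R1 k1 assume m: "m < M" and I: "I m N1 R1 k1"
    define h where "h = fst (search n ?e cs m)"
    define g where "g = snd (search n ?e cs m)"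
    have hg: "h \<le> n + 1" "g \<le> 2 * (n + 1)" "g \<ge> 1" using search_inv[of n ?e cs m] by (auto simp: h_def g_def)
    have v: "N1 rHI = h" "N1 rG = g" "N1 rT = 2 * m" "k1 = k" using I by (auto simp: I_def h_def g_def prod_eq_iff)
    have f: "\<forall>r. r \<notin> searchregs \<longrightarrow> N1 r = N r" and s1: "same R R1" using I by (auto simp: I_def)
    have regs1: "regs N1" by (rule regs_frame[OF N]) (use f in auto)
    have m2: "N1 rM2 = 2 * M" using regs1 by (simp add: regs_def)
    have "2 * g \<le> 4 * n + 4" using hg(2) by simp
    then have wb: "h < W" "2 * g < W" "g + 1 < W" "0 < W" using hg W_lin by auto
    define d where "d t = (psum n ?e cs t (h - g) \<noteq> 0)" for t
    define N2 where "N2 = N1(rQ := h - g, rFL := 0)"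
    have regs2: "regs N2" by (rule regs_frame[OF regs1]) (simp add: N2_def)
    have q: "h - g \<le> n" using hg by simp
    have t1: "ex W cs test_com (21 * n + 50) (\<lambda>N' R' k'. k' = k \<and> (\<forall>r. r \<notin> dotregs \<union> {rFL, rT} \<longrightarrow> N' r = N2 r) \<and>
        N' rT = Suc (2 * m) \<and> N' rFL = (if d (2 * m) then 1 else N2 rFL) \<and> same R1 R') N2 R1 k"
      unfolding d_def
      by (rule ex_test[OF regs2]) (use R s1 i f v m q in \<open>auto simp: N2_def intro: same_memAB same_memC same_tab\<close>)
    have t2: "ex W cs test_com (21 * n + 50) (\<lambda>N' R' k'. k' = k \<and> (\<forall>r. r \<notin> dotregs \<union> {rFL, rT} \<longrightarrow> N' r = N2 r) \<and>
        N' rT = Suc (Suc (2 * m)) \<and> N' rFL = (if d (2 * m) \<or> d (Suc (2 * m)) then 1 else 0) \<and> same R R') N3 R3 k"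
      if N3: "\<forall>r. r \<notin> dotregs \<union> {rFL, rT} \<longrightarrow> N3 r = N2 r" "N3 rT = Suc (2 * m)" "N3 rFL = (if d (2 * m) then 1 else N2 rFL)"
        and s3: "same R1 R3" for N3 R3
    proof -
      have regs3: "regs N3" by (rule regs_frame[OF regs2]) (use N3 in auto)
      have s: "same R R3" using same_trans[OF s1 s3] .
      have v3: "N3 rI = i" "N3 rQ = h - g" using N3 f i by (auto simp: N2_def)
      have "ex W cs test_com (21 * n + 50) (\<lambda>N' R' k'. k' = k \<and> (\<forall>r. r \<notin> dotregs \<union> {rFL, rT} \<longrightarrow> N' r = N3 r) \<and>
        N' rT = Suc (Suc (2 * m)) \<and> N' rFL = (if psum n ?e cs (Suc (2 * m)) (h - g) \<noteq> 0 then 1 else N3 rFL) \<and> same R3 R') N3 R3 k"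
        by (rule ex_test[OF regs3 same_memAB[OF s R(1)] same_memC[OF s R(2)] same_tab[OF s R(3)] v3(1) i(2) N3(2) _ v3(2) q])
          (use m in simp)
      then show ?thesis
        by (rule ex_mono) (use N3 s in \<open>auto simp: d_def N2_def same_def\<close>)
    qed
    have t3: "ex W cs (Cond (CEqN rFL rONE)
          (Block [NAdd rHI rQ rZ, NAdd rG rG rG])
          (Block [NAdd rG rG rONE, NDiv rG rG rTWO])) 4 (I (Suc m)) N3 R3 k"
      if N3: "\<forall>r. r \<notin> dotregs \<union> {rFL, rT} \<longrightarrow> N3 r = N2 r" "N3 rT = Suc (Suc (2 * m))"
           "N3 rFL = (if d (2 * m) \<or> d (Suc (2 * m)) then 1 else 0)" and s3: "same R R3" for N3 R3
    proof -
      have "regs N3" by (rule regs_frame[OF regs2]) (use N3 in auto)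
      then have v3: "N3 rONE = 1" "N3 rTWO = 2" "N3 rZ = 0" by (auto simp: regs_def)
      have w3: "N3 rHI = h" "N3 rG = g" "N3 rQ = h - g" using N3 v by (auto simp: N2_def)
      have f3: "\<forall>r. r \<notin> searchregs \<longrightarrow> N3 r = N r" using N3 f by (auto simp: N2_def)
      have se: "search n ?e cs (Suc m) = gallop (d (2 * m) \<or> d (Suc (2 * m))) (h, g)"
        by (simp add: Let_def detect_def d_def h_def g_def)
      have w: "h - g < W" "(g + 1) div 2 < W" "g + g < W" using wb by linarith+
      show ?thesis
      proof (cases "d (2 * m) \<or> d (Suc (2 * m))")
        case True
        then have "search n ?e cs (Suc m) = (h - g, g + g)" by (simp only: se gallop_def if_True fst_conv snd_conv mult_2)
        then have "wpb W cs [NAdd rHI rQ rZ, NAdd rG rG rG] (I (Suc m)) N3 R3 k"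
          using w f3 s3 v3 w3 N3(2) by (simp add: I_def del: search.simps)
        then show ?thesis using True N3(3) v3
          by (intro ex_Cond[where ba = 2 and bc = 2] ex_Block) auto
      next
        case False
        then have "search n ?e cs (Suc m) = (h, (g + 1) div 2)" by (simp only: se gallop_def if_False fst_conv snd_conv)
        then have "wpb W cs [NAdd rG rG rONE, NDiv rG rG rTWO] (I (Suc m)) N3 R3 k"
          using w wb f3 s3 v3 w3 N3(2) by (simp add: I_def del: search.simps)
        then show ?thesis using False N3(3) v3
          by (intro ex_Cond[where ba = 2 and bc = 2] ex_Block) auto
      qed
    qed
    have "ex W cs ?c (42 * n + 118) (I (Suc m)) N1 R1 k"
    proof (rule ex_Block_Seq[where bc = "42 * n + 110"])
      have "ex W cs (test_com ;; test_com ;;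
        Cond (CEqN rFL rONE)
          (Block [NAdd rHI rQ rZ, NAdd rG rG rG])
          (Block [NAdd rG rG rONE, NDiv rG rG rTWO])) (42 * n + 110) (I (Suc m)) N2 R1 k"
      proof (rule ex_SeqI[OF t1, where bc = "21 * n + 55"], goal_cases)
        case (1 N3 R3 k3)
        then have k3: "k3 = k" by simp
        show ?case unfolding k3
        proof (rule ex_SeqI[OF t2, where bc = 4], goal_cases)
          case (5 N4 R4 k4)
          then have k4: "k4 = k" by simp
          show ?case unfolding k4 by (rule t3) (use 5 in auto)
        qed (use 1 in auto)
      qed simp
      then show "wpb W cs [NSub rQ rHI rG, NConst rFL 0] (ex W cs (test_com ;; test_com ;;
        Cond (CEqN rFL rONE)
          (Block [NAdd rHI rQ rZ, NAdd rG rG rG])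
          (Block [NAdd rG rG rONE, NDiv rG rG rTWO])) (42 * n + 110) (I (Suc m))) N1 R1 k"
        using wb unfolding N2_def by (simp add: v)
    qed simp
    then show "cval (CLess rT rM2) N1 R1 \<and> ex W cs ?c (42 * n + 118) (I (Suc m)) N1 R1 k1"
      using v m2 m by simp
  next
    fix N' R' k' assume I: "I M N' R' k'"
    have "regs N'" by (rule regs_frame[OF N]) (use I in \<open>auto simp: I_def\<close>)
    then show "\<not> cval (CLess rT rM2) N' R' \<and> ?Q N' R' k'"
      using I by (auto simp: I_def regs_def prod_eq_iff)
  qed simp
  moreover have "n + 1 < W" "1 < W" using W_large by linarith+
  ultimately show "wpb W cs [NAdd rHI rN1 rZ, NConst rG 1, NConst rT 0]
     (ex W cs (While (CLess rT rM2) ?c) (M * (42 * n + 120) + 2) ?Q) N R k"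
    using N by (simp add: regs_def)
qed (use b in simp)

end

definition entry_com :: com where
  "entry_com =
     (Block [NMul rPA rI 0, NAdd rPB rNN rJ, NAdd rST 0 rZ, NAdd rLEN 0 rZ, NAdd rACC rX1 rZ] ;; dot_com) ;;
     Block [NMul rAUX rI 0, NAdd rAUX rAUX rCB, NAdd rAUX rAUX rJ, RCopy rAUX rX1]"

context correction
begin

lemma ex_entry:
  assumes N: "regs N" and R: "memAB R"
    and i: "N rI = i" "i < n" and j: "N rJ = j" "j < n" and b: "7 * n + 13 \<le> b"
  shows "ex W cs entry_com b (\<lambda>N' R' k'. k' = k \<and> (\<forall>r. r \<notin> dotregs \<longrightarrow> N' r = N r) \<and>
     same (R(2 * (n * n) + i * n + j := mat_mult n A B i j)) R') N R k"
proof -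
  let ?X = "3 * (n * n)"
  note ij = idx[OF i(2) j(2)]
  note bds = idx_end[OF i(2)] ij W_large j(2)
  have wb: "i * n < W" "n * n + j < W" "n < W" "?X < W" "i * n + 2 * (n * n) < W" "i * n + 2 * (n * n) + j < W"
    using bds by linarith+
  have A: "R (i * n + l) = A i l" if "l < n" for l using R i that by (simp add: memAB_def)
  have B: "R (n * n + j + l * n) = B l j" if "l < n" for l
    using R j that by (simp add: memAB_def algebra_simps)
  have 1: "ex W cs (Block [NMul rPA rI 0, NAdd rPB rNN rJ, NAdd rST 0 rZ, NAdd rLEN 0 rZ, NAdd rACC rX1 rZ] ;; dot_com)
     (7 * n + 9) (\<lambda>N' R' k'. k' = k \<and> (\<forall>r. r \<notin> dotregs \<longrightarrow> N' r = N r) \<and> R' ?X = mat_mult n A B i j \<and> same R R') N R k"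
    apply (rule ex_Block_Seq[where bc = "7 * n + 4"])
     apply simp
     apply (intro conjI)
          prefer 5
          apply (rule ex_mono[OF ex_dot[where L = n and x = ?X and y = "?X + 3" and a = "i * n"
             and b = "n * n + j" and s = n] order_refl])
    subgoal using N by (simp add: regs_def)
    subgoal using N by (simp add: regs_def)
    subgoal using N by (simp add: regs_def)
    subgoal by simp
    subgoal using N by (simp add: regs_def)
    subgoal using N i by (simp add: regs_def)
    subgoal using N j by (simp add: regs_def)
    subgoal using N by (simp add: regs_def)
    subgoal premises p for l using bds idx_end[OF p] p by linarith
    subgoal using bds by linarith
    subgoal using bds by linarith
    subgoal using bds by linarith
    subgoal by simp
    subgoal by (auto simp: same_def A B mat_mult_def)
    using N i j wb apply (simp_all add: regs_def)
    done
  show ?thesis unfolding entry_com_def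
  proof (rule ex_SeqI[OF 1, where bc = 4])
    fix N' R' k' assume a: "k' = k \<and> (\<forall>r. r \<notin> dotregs \<longrightarrow> N' r = N r) \<and> R' ?X = mat_mult n A B i j \<and> same R R'"
    then have "regs N'" by (intro regs_frame[OF N]) auto
    then have v: "N' 0 = n" "N' rCB = 2 * (n * n)" "N' rX1 = ?X" "N' rI = i" "N' rJ = j"
      using a i j by (auto simp: regs_def)
    have c: "i * n + 2 * (n * n) + j = 2 * (n * n) + i * n + j" by simp
    show "ex W cs (Block [NMul rAUX rI 0, NAdd rAUX rAUX rCB, NAdd rAUX rAUX rJ, RCopy rAUX rX1]) 4
      (\<lambda>N' R' k'. k' = k \<and> (\<forall>r. r \<notin> dotregs \<longrightarrow> N' r = N r) \<and>
     same (R(2 * (n * n) + i * n + j := mat_mult n A B i j)) R') N' R' k'"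
      using a v wb by (intro ex_Block) (auto simp: same_def c)
  qed (use b in simp)
qed

end

section \<open>Tabulating the prefix products\<close>

text \<open>\<open>S (Suc u)\<close> exceeds \<open>S u\<close> by column \<open>u mod n\<close> of
  \<open>B\<close> times \<open>V u\<close>, so a table row costs O(n). The operand 0 is the
  register that holds \<open>n\<close>: adding it moves \<open>rPB\<close> down the column and
  places \<open>rDST\<close> one table row ahead of \<open>rPA\<close>.\<close>

definition table_row_com :: com where
  "table_row_com =
     Block [NConst rL 0, NMul rPA rU 0, NAdd rPA rPA rSB, NAdd rDST rPA 0, NAdd rPB rNN rQ] ;;
     While (CLess rL 0)
       (Block [RMul rTMP rPB rVA, RAdd rDST rPA rTMP, NAdd rPA rPA rONE, NAdd rDST rDST rONE,
          NAdd rPB rPB 0, NAdd rL rL rONE])"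

definition tables_com :: com where
  "tables_com =
     Block [NConst rU 0] ;;
     While (CLess rU rVS)
       (Block [Coin rAUX, NAdd rVA rVB rU, NMod rQ rU 0] ;;
        Cond (CEqN rAUX rONE) (Block [ROne rVA]) (Block [RZero rVA]) ;;
        table_row_com ;;
        Block [NAdd rU rU rONE])"

context correction
begin

abbreviation (input) "sbase \<equiv> 3 * (n * n) + 4 + 2 * M * n"

lemma ex_table_row:
  assumes N: "regs N" and u: "N rU = u" "u < 2 * M * n" and q: "N rQ = u mod n" and a: "N rVA = 3 * (n * n) + 4 + u"
    and R: "memAB R" "R (3 * (n * n) + 4 + u) = V u" "\<And>l. l < n \<Longrightarrow> R (sbase + u * n + l) = S u l"
  shows "ex W cs table_row_com (8 * n + 7) (\<lambda>N' R' k'. k' = k \<and> (\<forall>r. r \<notin> {rL, rPA, rDST, rPB} \<longrightarrow> N' r = N r) \<and>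
     (\<forall>l<n. R' (sbase + Suc u * n + l) = S (Suc u) l) \<and>
     (\<forall>z. z \<noteq> 3 * (n * n) + 3 \<and> z < sbase + Suc u * n \<longrightarrow> R' z = R z)) N R k"
proof -
  let ?c = "Block [RMul rTMP rPB rVA, RAdd rDST rPA rTMP, NAdd rPA rPA rONE, NAdd rDST rDST rONE,
          NAdd rPB rPB 0, NAdd rL rL rONE]"
  let ?Q = "\<lambda>N' R' k'. k' = k \<and> (\<forall>r. r \<notin> {rL, rPA, rDST, rPB} \<longrightarrow> N' r = N r) \<and>
     (\<forall>l<n. R' (sbase + Suc u * n + l) = S (Suc u) l) \<and>
     (\<forall>z. z \<noteq> 3 * (n * n) + 3 \<and> z < sbase + Suc u * n \<longrightarrow> R' z = R z)"
  let ?q = "u mod n"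
  have qn: "?q < n" using n_pos by simp
  have un: "u * n + n \<le> 2 * M * n * n" using mult_le_mono1[of "Suc u" "2 * M * n" n] u by simp
  define p where "p = u * n + sbase"
  have wp: "p + 2 * n < W" "u * n < W" "n * n + ?q + n * n < W" using un W_large qn by (auto simp: p_def)
  define y where "y = 3 * (n * n) + 3"
  have y: "y < p" by (simp add: p_def y_def)
  define J where "J = (\<lambda>l N' R' k'. k' = k \<and> (\<forall>r. r \<notin> {rL, rPA, rDST, rPB} \<longrightarrow> N' r = N r) \<and>
     N' rL = l \<and> N' rPA = p + l \<and> N' rDST = p + n + l \<and> N' rPB = n * n + ?q + l * n \<and>
     (\<forall>l'<l. R' (p + n + l') = S (Suc u) l') \<and>
     (\<forall>z. z \<noteq> y \<and> z < p + n \<longrightarrow> R' z = R z))"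
  define N1 where "N1 = N(rL := 0, rPA := p, rDST := p + n, rPB := n * n + ?q)"
  have S: "S (Suc u) l = S u l + B l ?q * V u" for l by (simp add: S_def)
  have loop: "ex W cs (While (CLess rL 0) ?c) (8 * n + 2) ?Q N1 R k"
  proof (rule ex_While_const[where I = J and J = n and T = 6])
    have "N1 r = N r" if "r \<notin> {rL, rPA, rDST, rPB}" for r using that by (simp add: N1_def)
    then show "J 0 N1 R k" unfolding J_def by (simp add: N1_def)
  next
    fix l N' R' k' assume l: "l < n" and J: "J l N' R' k'"
    define pb where "pb = n * n + ?q + l * n"
    define va where "va = 3 * (n * n) + 4 + u"
    have k': "k' = k" and f: "\<And>r. r \<notin> {rL, rPA, rDST, rPB} \<Longrightarrow> N' r = N r"
      and v: "N' rL = l" "N' rPA = p + l" "N' rDST = p + n + l" "N' rPB = pb"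
      and R1: "\<And>l'. l' < l \<Longrightarrow> R' (p + n + l') = S (Suc u) l'"
      and R2: "\<And>z. z \<noteq> y \<Longrightarrow> z < p + n \<Longrightarrow> R' z = R z"
      using J by (auto simp: J_def pb_def)
    have c: "N' 0 = n" "N' rTMP = y" "N' rVA = va" "N' rONE = 1"
      using f N a by (auto simp: regs_def y_def va_def)
    have ln: "l * n + n \<le> n * n" using idx_end[OF l] .
    have pb: "pb < 3 * (n * n)" using ln qn unfolding pb_def by linarith
    have b1: "R' pb = B l ?q"
    proof -
      have "pb \<noteq> y" "pb < p + n" using pb y unfolding y_def by linarith+
      then have "R' pb = R pb" by (rule R2)
      moreover have e: "pb = n * n + l * n + ?q" by (simp add: pb_def)
      have "R pb = B l ?q" unfolding e using R(1) l qn by (simp add: memAB_def)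
      ultimately show ?thesis by simp
    qed
    have "va \<noteq> y" "va < p + n" using u unfolding va_def y_def p_def by linarith+
    then have b2: "R' va = V u" using R2[of va] R(2) by (simp add: va_def)
    have "p + l \<noteq> y" "p + l < p + n" using y l by linarith+
    moreover have "p + l = sbase + u * n + l" by (simp add: p_def)
    ultimately have b3: "R' (p + l) = S u l" using R2[of "p + l"] R(3)[OF l] by simp
    have w: "Suc (p + l) < W" "Suc (p + n + l) < W" "pb + n < W" "Suc l < W"
      using wp l ln W_lin unfolding pb_def by linarith+
    have pbn: "pb + n = n * n + ?q + Suc l * n" by (simp add: pb_def)
    define R'' where "R'' = R'(y := B l ?q * V u, p + n + l := S (Suc u) l)"
    have "R'' (p + n + l') = S (Suc u) l'" if "l' < Suc l" for l'
      using R1[of l'] that y by (auto simp: R''_def less_Suc_eq)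
    moreover have "R'' z = R z" if "z \<noteq> y" "z < p + n" for z
      using R2[OF that] that by (simp add: R''_def)
    ultimately have "J (Suc l) (N'(rPA := Suc (p + l), rDST := Suc (p + n + l), rPB := pb + n, rL := Suc l)) R'' k"
      using f unfolding pbn J_def by simp
    then have "wpb W cs [RMul rTMP rPB rVA, RAdd rDST rPA rTMP, NAdd rPA rPA rONE, NAdd rDST rDST rONE,
          NAdd rPB rPB 0, NAdd rL rL rONE] (J (Suc l)) N' R' k"
      using w y by (simp add: v c b1 b2 b3 R''_def S)
    then show "cval (CLess rL 0) N' R' \<and> ex W cs ?c 6 (J (Suc l)) N' R' k'"
      using v c l unfolding k' by (auto intro: ex_Block)
  next
    fix N' R' k' assume J: "J n N' R' k'"
    have "N' 0 = n" using J N by (auto simp: J_def regs_def)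
    moreover have pn: "sbase + Suc u * n = p + n" by (simp add: p_def)
    ultimately show "\<not> cval (CLess rL 0) N' R' \<and> ?Q N' R' k'" unfolding pn using J by (simp add: J_def y_def)
  qed simp
  show ?thesis unfolding table_row_com_def
  proof (rule ex_Block_Seq[where bc = "8 * n + 2"])
    have "u * n + sbase < W" "u * n + sbase + n < W" "n * n + ?q < W" "0 < W" "u * n < W"
      using wp unfolding p_def by linarith+
    then show "wpb W cs [NConst rL 0, NMul rPA rU 0, NAdd rPA rPA rSB, NAdd rDST rPA 0, NAdd rPB rNN rQ]
       (ex W cs (While (CLess rL 0) ?c) (8 * n + 2) ?Q) N R k"
      using loop N u q unfolding N1_def p_def regs_def
      by (simp only: wpb.simps fun_upd_apply fun_upd_upd if_True if_False refl simp_thms numeral_eq_iff num.simps semiring_norm zero_neq_numeral numeral_neq_zero)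
  qed simp
qed

lemma ex_tables:
  assumes N: "regs N" and R: "memAB R" "memC C R" "tab 0 R"
  shows "ex W cs tables_com (2 * M * n * (8 * n + 17) + 3)
    (\<lambda>N' R' k'. regs N' \<and> memAB R' \<and> memC C R' \<and> tab (2 * M * n) R') N R 0"
proof -
  let ?c = "Block [Coin rAUX, NAdd rVA rVB rU, NMod rQ rU 0] ;;
        Cond (CEqN rAUX rONE) (Block [ROne rVA]) (Block [RZero rVA]) ;;
        table_row_com ;;
        Block [NAdd rU rU rONE]"
  let ?Q = "\<lambda>N' R' k'. regs N' \<and> memAB R' \<and> memC C R' \<and> tab (2 * M * n) R'"
  \<comment> \<open>The coin counter agrees with \<open>u\<close>, so the coin read next is
    \<open>cs u\<close>, as \<open>V u\<close> demands.\<close>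
  define J where "J = (\<lambda>u N' R' k'. k' = u \<and> regs N' \<and> N' rU = u \<and> memAB R' \<and> memC C R' \<and> tab u R')"
  have body: "ex W cs ?c (8 * n + 15) (J (Suc u)) N1 R1 k1" if u: "u < 2 * M * n" and J: "J u N1 R1 k1" for u N1 R1 k1
  proof -
    have v: "k1 = u" "regs N1" "N1 rU = u" "memAB R1" "memC C R1" "tab u R1" using J by (auto simp: J_def)
    define a where "a = 3 * (n * n) + 4 + u"
    have wa: "a < W" "1 < W" "Suc u < W" "u mod n < W"
      using u W_large mod_less_eq_dividend[of u n] unfolding a_def by linarith+
    define N2 where "N2 = N1(rAUX := (if cs u then 1 else 0), rVA := a, rQ := u mod n)"
    define R2 where "R2 = R1(a := V u)"
    have r2: "regs N2" by (rule regs_frame[OF v(2)]) (auto simp: N2_def)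
    have z: "R2 z = R1 z" if "z \<noteq> a" for z using that by (simp add: R2_def)
    have m2: "memAB R2" unfolding memAB_def
    proof (intro allI impI)
      fix i j assume ij: "i < n" "j < n"
      have "i * n + j \<noteq> a" "n * n + i * n + j \<noteq> a" using idx[OF ij] unfolding a_def by linarith+
      then show "R2 (i * n + j) = A i j \<and> R2 (n * n + i * n + j) = B i j" using z v(4) ij by (simp add: memAB_def)
    qed
    have row: "ex W cs table_row_com (8 * n + 7) (\<lambda>N' R' k'. k' = Suc u \<and> (\<forall>r. r \<notin> {rL, rPA, rDST, rPB} \<longrightarrow> N' r = N2 r) \<and>
     (\<forall>l<n. R' (sbase + Suc u * n + l) = S (Suc u) l) \<and>
     (\<forall>z. z \<noteq> 3 * (n * n) + 3 \<and> z < sbase + Suc u * n \<longrightarrow> R' z = R2 z)) N2 R2 (Suc u)"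
    proof (rule ex_table_row[OF r2 _ u _ _ m2])
      fix l assume "l < n"
      then show "R2 (sbase + u * n + l) = S u l"
        using z[of "sbase + u * n + l"] v(6) u by (simp add: tab_def a_def)
    qed (use v in \<open>auto simp: N2_def R2_def a_def\<close>)
    have last: "ex W cs (Block [NAdd rU rU rONE]) 1 (J (Suc u)) N3 R3 k3"
      if a3: "k3 = Suc u \<and> (\<forall>r. r \<notin> {rL, rPA, rDST, rPB} \<longrightarrow> N3 r = N2 r) \<and>
     (\<forall>l<n. R3 (sbase + Suc u * n + l) = S (Suc u) l) \<and>
     (\<forall>z. z \<noteq> 3 * (n * n) + 3 \<and> z < sbase + Suc u * n \<longrightarrow> R3 z = R2 z)" for N3 R3 k3
    proof -
      have z3: "R3 z = R1 z" if "z \<noteq> a" "z \<noteq> 3 * (n * n) + 3" "z < sbase + Suc u * n" for z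
        using a3 z[OF that(1)] that(2,3) by simp
      have z4: "R3 z = R1 z" if "z < 3 * (n * n)" for z
      proof (rule z3)
        show "z \<noteq> a" "z \<noteq> 3 * (n * n) + 3" "z < sbase + Suc u * n" using that unfolding a_def by linarith+
      qed
      have "a \<noteq> 3 * (n * n) + 3" "a < sbase + Suc u * n" using u unfolding a_def by linarith+
      then have R3a: "R3 a = V u" using a3 by (simp add: R2_def)
      have r3: "regs N3" by (rule regs_frame[OF r2]) (use a3 in auto)
      have "memAB R3" unfolding memAB_def
      proof (intro allI impI)
        fix i j assume ij: "i < n" "j < n"
        have "R3 (i * n + j) = R1 (i * n + j)"
          by (rule z4) (use idx[OF ij] in linarith)
        moreover have "R3 (n * n + i * n + j) = R1 (n * n + i * n + j)"
          by (rule z4) (use idx[OF ij] in linarith)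
        ultimately show "R3 (i * n + j) = A i j \<and> R3 (n * n + i * n + j) = B i j" using v(4) ij by (simp add: memAB_def)
      qed
      moreover have "memC C R3" unfolding memC_def
      proof (intro allI impI)
        fix i j assume ij: "i < n" "j < n"
        have "R3 (2 * (n * n) + i * n + j) = R1 (2 * (n * n) + i * n + j)"
          by (rule z4) (use idx[OF ij] in linarith)
        then show "R3 (2 * (n * n) + i * n + j) = C i j" using v(5) ij by (simp add: memC_def)
      qed
      moreover have "tab (Suc u) R3" unfolding tab_def
      proof (intro conjI allI impI)
        fix u' assume u': "u' < Suc u"
        show "R3 (3 * (n * n) + 4 + u') = V u'"
        proof (cases "u' = u")
          case True then show ?thesis using R3a by (simp add: a_def)
        next
          case False
          have "R3 (3 * (n * n) + 4 + u') = R1 (3 * (n * n) + 4 + u')"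
          proof (rule z3)
            show "3 * (n * n) + 4 + u' \<noteq> a" "3 * (n * n) + 4 + u' \<noteq> 3 * (n * n) + 3"
              "3 * (n * n) + 4 + u' < sbase + Suc u * n" using False u' u unfolding a_def by linarith+
          qed
          then show ?thesis using v(6) False u' by (simp add: tab_def)
        qed
      next
        fix u' l assume u': "u' \<le> Suc u" and l: "l < n"
        show "R3 (sbase + u' * n + l) = S u' l"
        proof (cases "u' = Suc u")
          case True then show ?thesis using a3 l by blast
        next
          case False
          then have "u' \<le> u" using u' by simp
          then have "u' * n \<le> u * n" by (rule mult_le_mono1)
          then have "u' * n + l < n + u * n" using l by linarith
          then have "sbase + u' * n + l < sbase + Suc u * n" by simp
          moreover have "sbase + u' * n + l \<noteq> a" "sbase + u' * n + l \<noteq> 3 * (n * n) + 3"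
            using u unfolding a_def by linarith+
          ultimately have "R3 (sbase + u' * n + l) = R1 (sbase + u' * n + l)" by (intro z3)
          then show ?thesis using v(6) \<open>u' \<le> u\<close> l by (simp add: tab_def)
        qed
      qed
      moreover have "regs (N3(rU := Suc u))" by (rule regs_frame[OF r3]) auto
      ultimately have "J (Suc u) (N3(rU := Suc u)) R3 (Suc u)" by (simp add: J_def)
      moreover have "N3 rU = u" "N3 rONE = 1" "k3 = Suc u" using a3 v(3) r3 by (auto simp: N2_def regs_def)
      ultimately show ?thesis using wa by (intro ex_Block) auto
    qed
    have cond: "ex W cs (Cond (CEqN rAUX rONE) (Block [ROne rVA]) (Block [RZero rVA])) 3
        (\<lambda>N' R' k'. N' = N2 \<and> R' = R2 \<and> k' = Suc u) N2 R1 (Suc u)"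
    proof -
      have n2: "N2 rONE = 1" "N2 rVA = a" "N2 rAUX = (if cs u then 1 else 0)" using r2 by (auto simp: regs_def N2_def)
      let ?Q = "\<lambda>N' R' k'. N' = N2 \<and> R' = R2 \<and> k' = Suc u"
      show ?thesis
      proof (cases "cs u")
        case True
        then have "wpb W cs [ROne rVA] ?Q N2 R1 (Suc u)" using n2 by (simp add: R2_def V_def)
        then have "ex W cs (Block [ROne rVA]) 1 ?Q N2 R1 (Suc u)" by (rule ex_Block) simp
        then show ?thesis by (rule ex_Cond[where ba = 1 and bc = 1]) (use n2 True in simp_all)
      next
        case False
        then have "wpb W cs [RZero rVA] ?Q N2 R1 (Suc u)" using n2 by (simp add: R2_def V_def)
        then have "ex W cs (Block [RZero rVA]) 1 ?Q N2 R1 (Suc u)" by (rule ex_Block) simp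
        then show ?thesis by (intro ex_Cond[where ba = 1 and bc = 1]) (use n2 False in simp_all)
      qed
    qed
    have rest: "ex W cs (Cond (CEqN rAUX rONE) (Block [ROne rVA]) (Block [RZero rVA]) ;;
        table_row_com ;; Block [NAdd rU rU rONE]) (8 * n + 12) (J (Suc u)) N2 R1 (Suc u)"
    proof (rule ex_SeqI[OF cond, where bc = "8 * n + 8"])
      fix N' R' k' assume a: "N' = N2 \<and> R' = R2 \<and> k' = Suc u"
      have "ex W cs (table_row_com ;; Block [NAdd rU rU rONE]) (8 * n + 8) (J (Suc u)) N2 R2 (Suc u)"
        by (rule ex_SeqI[OF row, where bc = 1], rule last, assumption, simp)
      then show "ex W cs (table_row_com ;; Block [NAdd rU rU rONE]) (8 * n + 8) (J (Suc u)) N' R' k'" using a by simp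
    qed simp
    show ?thesis
    proof (rule ex_Block_Seq[where bc = "8 * n + 12"])
      have "N1 rVB = 3 * (n * n) + 4" "N1 0 = n" using v(2) by (auto simp: regs_def)
      then show "wpb W cs [Coin rAUX, NAdd rVA rVB rU, NMod rQ rU 0] (ex W cs (Cond (CEqN rAUX rONE) (Block [ROne rVA]) (Block [RZero rVA]) ;;
        table_row_com ;; Block [NAdd rU rU rONE]) (8 * n + 12) (J (Suc u))) N1 R1 k1"
        using wa rest v(1,3) unfolding a_def N2_def by (simp only: wpb.simps fun_upd_apply) simp
    qed simp
  qed
  define N1 where "N1 = N(rU := 0)"
  have loop: "ex W cs (While (CLess rU rVS) ?c) (2 * M * n * (8 * n + 17) + 2) ?Q N1 R 0"
  proof (rule ex_While_const[where I = J and J = "2 * M * n" and T = "8 * n + 15"])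
    have "regs N1" by (rule regs_frame[OF N]) (auto simp: N1_def)
    then show "J 0 N1 R 0" using R by (simp add: J_def N1_def)
  next
    fix u N1 R1 k1 assume u: "u < 2 * M * n" and J: "J u N1 R1 k1"
    have "N1 rU = u" "N1 rVS = 2 * M * n" using J by (auto simp: J_def regs_def)
    then show "cval (CLess rU rVS) N1 R1 \<and> ex W cs ?c (8 * n + 15) (J (Suc u)) N1 R1 k1"
      using body[OF u J] u by simp
  next
    fix N1 R1 k1 assume "J (2 * M * n) N1 R1 k1"
    then show "\<not> cval (CLess rU rVS) N1 R1 \<and> ?Q N1 R1 k1" by (auto simp: J_def regs_def)
  next
    have "8 * n + 15 + 2 = 8 * n + 17" by simp
    then show "2 * M * n * (8 * n + 15 + 2) + 2 \<le> 2 * M * n * (8 * n + 17) + 2" by (simp only: order_refl)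
  qed
  show ?thesis unfolding tables_com_def
  proof (rule ex_Block_Seq[where bc = "2 * M * n * (8 * n + 17) + 2"])
    show "wpb W cs [NConst rU 0] (ex W cs (While (CLess rU rVS) ?c) (2 * M * n * (8 * n + 17) + 2) ?Q) N R 0"
      using loop W_lin unfolding N1_def by simp
  qed simp
qed

end

section \<open>Correcting the rows\<close>

text \<open>The threshold is tested once per row, so a row is either searched to its end or
  recomputed entirely. \<open>rHI\<close> starts at 0 only to enter the loop, which is left at the
  value \<open>n + 1\<close> of a clean row.\<close>

definition row_com :: com where
  "row_com =
     Block [NMul rAUX rF rM] ;;
     Cond (CLess rAUX rNN)
       (Block [NConst rHI 0] ;;
        While (CLess rHI rN1)
          (search_com ;;
           Cond (CLess rHI rN1)
             (Block [NSub rJ rHI rONE] ;; entry_com ;; Block [NAdd rF rF rONE])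
             (Block [])))
       (Block [NConst rJ 0] ;; While (CLess rJ 0) (entry_com ;; Block [NAdd rJ rJ rONE])) ;;
     Block [NAdd rI rI rONE]"

context correction
begin

definition E :: "nat \<Rightarrow> nat \<Rightarrow> 'a" where
  "E i j = mat_mult n A B i j - C i j"

text \<open>The matrix in the region of \<open>C'\<close> when all positions lexicographically before \<open>(i, s)\<close> are correct.\<close>

definition cur :: "nat \<Rightarrow> nat \<Rightarrow> nat \<Rightarrow> nat \<Rightarrow> 'a" where
  "cur i s i' j' = (if i' < i \<or> (i' = i \<and> j' < s) then mat_mult n A B i' j' else C i' j')"

definition errs :: "nat \<Rightarrow> nat \<Rightarrow> nat" where
  "errs i s = card {j. s \<le> j \<and> j < n \<and> E i j \<noteq> 0}"

definition row_inv :: "nat \<Rightarrow> nat \<Rightarrow> (nat \<Rightarrow> nat) \<Rightarrow> (nat \<Rightarrow> 'a) \<Rightarrow> bool" where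
  "row_inv i s N R \<longleftrightarrow> regs N \<and> memAB R \<and> memC (cur i s) R \<and> tab (2 * M * n) R \<and> N rI = i"

lemma memC_cong: "memC D R \<Longrightarrow> (\<And>i j. i < n \<Longrightarrow> j < n \<Longrightarrow> D i j = D' i j) \<Longrightarrow> memC D' R"
  by (simp add: memC_def)

lemma errs_le: "errs i s \<le> n"
proof -
  have "errs i s \<le> card {..<n}" unfolding errs_def by (intro card_mono) auto
  then show ?thesis by simp
qed

lemma idx_eq:
  assumes "j < n" "j' < n" "i * n + j = i' * n + j'" shows "i = i' \<and> j = j'"
proof -
  have "(i * n + j) div n = i" "(i' * n + j') div n = i'" using assms(1,2) by auto
  then have "i = i'" using assms(3) by simp
  then show ?thesis using assms(3) by simp
qed

lemma entry_mem:
  assumes i: "i < n" "j < n" and s: "same (R(2 * (n * n) + i * n + j := x)) R'"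
    and R: "memAB R" "memC D R" "tab (2 * M * n) R"
  shows "memAB R'" "memC (\<lambda>i' j'. if i' = i \<and> j' = j then x else D i' j') R'" "tab (2 * M * n) R'"
proof -
  let ?R = "R(2 * (n * n) + i * n + j := x)"
  note ij = idx[OF i]
  have "R z = ?R z" if "z < 2 * (n * n) \<or> 3 * (n * n) \<le> z" for z using ij that by auto
  note * = this
  have "memAB ?R" unfolding memAB_def
  proof (intro allI impI)
    fix i' j' assume "i' < n" "j' < n"
    then have "i' * n + j' < 2 * (n * n)" "n * n + i' * n + j' < 2 * (n * n)" using idx[of i' j'] by linarith+
    then show "?R (i' * n + j') = A i' j' \<and> ?R (n * n + i' * n + j') = B i' j'"
      using R(1) \<open>i' < n\<close> \<open>j' < n\<close> by (auto simp: memAB_def)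
  qed
  then show "memAB R'" using s same_memAB by blast
  have "memC (\<lambda>i' j'. if i' = i \<and> j' = j then x else D i' j') ?R"
    using R(2) idx_eq[of _ j _ i] i by (auto simp: memC_def)
  then show "memC (\<lambda>i' j'. if i' = i \<and> j' = j then x else D i' j') R'" using s same_memC by blast
  have "tab (2 * M * n) ?R" using R(3) ij by (auto simp: tab_def)
  then show "tab (2 * M * n) R'" using s same_tab by blast
qed

text \<open>Everything between \<open>s\<close> and the error found is already correct, so repairing
  column \<open>x - 1\<close> takes the row from state \<open>s\<close> straight to state
  \<open>x\<close>, with one error fewer. This keeps the row among the states covered by
  \<open>good\<close>.\<close>

lemma first_err_tail:
  assumes "s \<le> n" "x = first_err n (tail s (E i))"
  shows "x = n + 1 \<and> errs i s = 0 \<and> (\<forall>j. s \<le> j \<and> j < n \<longrightarrow> E i j = 0) \<or>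
    (1 \<le> x \<and> x \<le> n \<and> s < x \<and> errs i s = Suc (errs i x) \<and> (\<forall>j. s \<le> j \<and> j < x - 1 \<longrightarrow> E i j = 0))"
proof -
  have z: "E i j = 0" if "s \<le> j" "j + 1 < x" for j
    using zero_before_first_err[of j n "tail s (E i)"] that assms(2) by (simp add: tail_def)
  from first_err_cases[of n "tail s (E i)"] consider "x = n + 1" |
    "1 \<le> x" "x \<le> n" "tail s (E i) (x - 1) \<noteq> 0" using assms(2) by auto
  then show ?thesis
  proof cases
    case 1
    then have *: "\<forall>j. s \<le> j \<and> j < n \<longrightarrow> E i j = 0" using z by auto
    then have "{j. s \<le> j \<and> j < n \<and> E i j \<noteq> 0} = {}" by auto
    then show ?thesis using 1 * unfolding errs_def by simp
  next
    case 2
    then have x: "s \<le> x - 1" "E i (x - 1) \<noteq> 0" by (auto simp: tail_def split: if_splits)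
    have "{j. s \<le> j \<and> j < n \<and> E i j \<noteq> 0} = insert (x - 1) {j. x \<le> j \<and> j < n \<and> E i j \<noteq> 0}"
    proof (intro equalityI subsetI)
      fix j assume "j \<in> {j. s \<le> j \<and> j < n \<and> E i j \<noteq> 0}"
      moreover from this have "\<not> j + 1 < x" using z[of j] by auto
      then have "j = x - 1 \<or> x \<le> j" by linarith
      ultimately show "j \<in> insert (x - 1) {j. x \<le> j \<and> j < n \<and> E i j \<noteq> 0}" by auto
    qed (use x 2 in auto)
    moreover have "card (insert (x - 1) {j. x \<le> j \<and> j < n \<and> E i j \<noteq> 0}) = Suc (errs i x)"
      unfolding errs_def using 2 by (intro card_insert_disjoint) auto
    ultimately have "errs i s = Suc (errs i x)" unfolding errs_def by simp
    then show ?thesis using 2 x z by auto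
  qed
qed

text \<open>Every search but the last finds one error, so \<open>errs i 0 + 1\<close> searches are
  made. The last one reports \<open>n + 1\<close>, which under \<open>good\<close> implies that the
  row is clean.\<close>

lemma ex_search_row:
  assumes G: "good n M E cs" and i: "i < n" and I: "row_inv i 0 N R" and F: "N rF = F" "F + errs i 0 \<le> n * n"
    and b: "(errs i 0 + 1) * (M * (42 * n + 120) + 7 * n + 25) + 3 \<le> b"
  shows "ex W cs (Block [NConst rHI 0] ;;
        While (CLess rHI rN1)
          (search_com ;;
           Cond (CLess rHI rN1)
             (Block [NSub rJ rHI rONE] ;; entry_com ;; Block [NAdd rF rF rONE])
             (Block []))) b
     (\<lambda>N' R' k'. k' = k \<and> row_inv i n N' R' \<and> N' rF = F + errs i 0) N R k"
proof -
  let ?r = "errs i 0"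
  let ?Q = "\<lambda>N' R' k'. k' = k \<and> row_inv i n N' R' \<and> N' rF = F + errs i 0"
  let ?fix = "Block [NSub rJ rHI rONE] ;; entry_com ;; Block [NAdd rF rF rONE]"
  let ?c = "search_com ;; Cond (CLess rHI rN1) ?fix (Block [])"
  let ?T = "M * (42 * n + 120) + 7 * n + 23"
  define J where "J = (\<lambda>m N' R' k'. k' = k \<and>
     (m \<le> ?r \<and> N' rHI < n + 1 \<and> N' rF = F + m \<and> (\<exists>s\<le>n. errs i s = ?r - m \<and> row_inv i s N' R') \<or>
      m = ?r + 1 \<and> N' rHI = n + 1 \<and> N' rF = F + ?r \<and> row_inv i n N' R'))"
  have step: "ex W cs ?c ?T (J (Suc m)) N1 R1 k"
    if m: "m \<le> ?r" and N1: "N1 rF = F + m" and s: "s \<le> n" "errs i s = ?r - m" "row_inv i s N1 R1" for m s N1 R1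
  proof -
    have v: "regs N1" "memAB R1" "memC (cur i s) R1" "tab (2 * M * n) R1" "N1 rI = i"
      using s(3) by (auto simp: row_inv_def)
    define x where "x = first_err n (tail s (E i))"
    \<comment> \<open>Repaired entries have difference 0 and the others still have their input
      error, so the current row of differences is exactly state \<open>s\<close> of
      \<open>good\<close>.\<close>
    have e: "(\<lambda>j. mat_mult n A B i j - cur i s i j) = tail s (E i)"
      by (auto simp: fun_eq_iff cur_def tail_def E_def)
    have sx: "fst (search n (tail s (E i)) cs M) = x" using G i s(1) by (simp add: good_def x_def)
    have se: "ex W cs search_com (M * (42 * n + 120) + 5)
       (\<lambda>N' R' k'. k' = k \<and> (\<forall>r. r \<notin> searchregs \<longrightarrow> N' r = N1 r) \<and> N' rHI = x \<and> same R1 R') N1 R1 k"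
      using ex_search[OF v i order_refl, of k] unfolding e sx .
    show ?thesis
    proof (rule ex_SeqI[OF se, where bc = "7 * n + 17"])
      fix N2 R2 k2
      assume a: "k2 = k \<and> (\<forall>r. r \<notin> searchregs \<longrightarrow> N2 r = N1 r) \<and> N2 rHI = x \<and> same R1 R2"
      then have k2: "k2 = k" and f2: "\<And>r. r \<notin> searchregs \<Longrightarrow> N2 r = N1 r" and x2: "N2 rHI = x" and s2: "same R1 R2" by auto
      have r2: "regs N2" by (rule regs_frame[OF v(1)]) (use f2 in auto)
      have m2: "memAB R2" "memC (cur i s) R2" "tab (2 * M * n) R2"
        using same_memAB[OF s2 v(2)] same_memC[OF s2 v(3)] same_tab[OF s2 v(4)] .
      have w2: "N2 rI = i" "N2 rF = F + m" "N2 rN1 = n + 1" "N2 rONE = 1" using f2 v(5) N1 r2 by (auto simp: regs_def)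
      show "ex W cs (Cond (CLess rHI rN1) ?fix (Block [])) (7 * n + 17) (J (Suc m)) N2 R2 k2"
        unfolding k2
      proof (rule ex_Cond[where ba = "7 * n + 16" and bc = 0])
        assume "\<not> cval (CLess rHI rN1) N2 R2"
        then have "x = n + 1 \<and> errs i s = 0 \<and> (\<forall>j. s \<le> j \<and> j < n \<longrightarrow> E i j = 0)"
          using first_err_tail[OF s(1) x_def] x2 w2 by auto
        then have x: "x = n + 1" "errs i s = 0" "\<And>j. s \<le> j \<Longrightarrow> j < n \<Longrightarrow> E i j = 0" by auto
        have "memC (cur i n) R2"
          by (rule memC_cong[OF m2(2)]) (use x(3) in \<open>auto simp: cur_def E_def\<close>)
        then have "row_inv i n N2 R2" using r2 m2 w2 by (simp add: row_inv_def)
        then have "J (Suc m) N2 R2 k" using x x2 s(2) m w2 by (simp add: J_def)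
        then show "ex W cs (Block []) 0 (J (Suc m)) N2 R2 k" by (intro ex_Block) auto
      next
        assume "cval (CLess rHI rN1) N2 R2"
        then have "x \<le> n" using x2 w2 by simp
        then have x: "1 \<le> x" "x \<le> n" "s < x" "errs i s = Suc (errs i x)" "\<And>j. s \<le> j \<Longrightarrow> j < x - 1 \<Longrightarrow> E i j = 0"
          using first_err_tail[OF s(1) x_def] by auto
        define N3 where "N3 = N2(rJ := x - 1)"
        have r3: "regs N3" by (rule regs_frame[OF r2]) (simp add: N3_def)
        have w3: "N3 rI = i" "N3 rJ = x - 1" "x - 1 < n" using w2 x by (auto simp: N3_def)
        note en = ex_entry[OF r3 m2(1) w3(1) i w3(2,3) order_refl, of k]
        have "ex W cs (entry_com ;; Block [NAdd rF rF rONE]) (7 * n + 14) (J (Suc m)) N3 R2 k"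
        proof (rule ex_SeqI[OF en, where bc = 1])
          fix N4 R4 k4
          assume a: "k4 = k \<and> (\<forall>r. r \<notin> dotregs \<longrightarrow> N4 r = N3 r) \<and>
            same (R2(2 * (n * n) + i * n + (x - 1) := mat_mult n A B i (x - 1))) R4"
          then have k4: "k4 = k" and f4: "\<And>r. r \<notin> dotregs \<Longrightarrow> N4 r = N3 r" by auto
          have r4: "regs N4" by (rule regs_frame[OF r3]) (use f4 in auto)
          from entry_mem[OF i w3(3) _ m2] a
          have m4: "memAB R4" "memC (\<lambda>i' j'. if i' = i \<and> j' = x - 1 then mat_mult n A B i (x - 1) else cur i s i' j') R4"
            "tab (2 * M * n) R4" by blast+
          have "memC (cur i x) R4"
          proof (rule memC_cong[OF m4(2)])
            fix i' j'
            show "(if i' = i \<and> j' = x - 1 then mat_mult n A B i (x - 1) else cur i s i' j') = cur i x i' j'"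
              using x(1,3) x(5)[of j'] by (auto simp: cur_def E_def)
          qed
          moreover have w4: "N4 rI = i" "N4 rHI = x" "N4 rF = F + m" "N4 rONE = 1"
            using f4 w3 w2 x2 r4 by (auto simp: N3_def regs_def)
          moreover have "regs (N4(rF := F + m + 1))" by (rule regs_frame[OF r4]) auto
          ultimately have "row_inv i x (N4(rF := F + m + 1)) R4" using m4 by (simp add: row_inv_def)
          moreover have "Suc m \<le> ?r" "errs i x = ?r - Suc m" using x(4) s(2) m by auto
          ultimately have "J (Suc m) (N4(rF := F + m + 1)) R4 k" using x(2) w4 unfolding J_def by auto
          moreover have "F + m + 1 < W" using F(2) m W_large by linarith
          ultimately show "ex W cs (Block [NAdd rF rF rONE]) 1 (J (Suc m)) N4 R4 k4"
            unfolding k4 using w4 by (intro ex_Block) auto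
        qed simp
        moreover have "x - 1 < W" using x(2) W_lin by linarith
        ultimately show "ex W cs ?fix (7 * n + 16) (J (Suc m)) N2 R2 k"
          unfolding N3_def using x2 w2 by (intro ex_Block_Seq[where bc = "7 * n + 14"]) auto
      qed auto
    qed simp
  qed
  have loop: "ex W cs (While (CLess rHI rN1) ?c) ((?r + 1) * (M * (42 * n + 120) + 7 * n + 25) + 2) ?Q (N(rHI := 0)) R k"
  proof (rule ex_While_const[where I = J and J = "?r + 1" and T = ?T])
    have "regs (N(rHI := 0))" by (rule regs_frame[of N]) (use I in \<open>auto simp: row_inv_def\<close>)
    then have "row_inv i 0 (N(rHI := 0)) R" using I by (simp add: row_inv_def)
    then show "J 0 (N(rHI := 0)) R k" using F by (auto simp: J_def)
  next
    fix m N1 R1 k1 assume m: "m < ?r + 1" and J: "J m N1 R1 k1"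
    then obtain s where s: "s \<le> n" "errs i s = ?r - m" "row_inv i s N1 R1" and N1: "N1 rHI < n + 1" "N1 rF = F + m" "k1 = k"
      by (auto simp: J_def)
    have "N1 rN1 = n + 1" using s(3) by (simp add: row_inv_def regs_def)
    then show "cval (CLess rHI rN1) N1 R1 \<and> ex W cs ?c ?T (J (Suc m)) N1 R1 k1"
      using step[OF _ N1(2) s] m N1 by simp
  next
    fix N1 R1 k1 assume "J (?r + 1) N1 R1 k1"
    then show "\<not> cval (CLess rHI rN1) N1 R1 \<and> ?Q N1 R1 k1"
      by (auto simp: J_def row_inv_def regs_def)
  next
    have "?T + 2 = M * (42 * n + 120) + 7 * n + 25" by simp
    then show "(?r + 1) * (?T + 2) + 2 \<le> (?r + 1) * (M * (42 * n + 120) + 7 * n + 25) + 2" by (simp only: order_refl)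
  qed
  show ?thesis
    by (rule ex_Block_Seq[where bc = "(?r + 1) * (M * (42 * n + 120) + 7 * n + 25) + 2"])
      (use loop b W_lin in \<open>auto\<close>)
qed

lemma ex_brute_row:
  assumes i: "i < n" and I: "row_inv i 0 N R" and b: "n * (7 * n + 16) + 3 \<le> b"
  shows "ex W cs (Block [NConst rJ 0] ;; While (CLess rJ 0) (entry_com ;; Block [NAdd rJ rJ rONE])) b
     (\<lambda>N' R' k'. k' = k \<and> row_inv i n N' R' \<and> N' rF = N rF) N R k"
proof -
  let ?Q = "\<lambda>N' R' k'. k' = k \<and> row_inv i n N' R' \<and> N' rF = N rF"
  let ?c = "entry_com ;; Block [NAdd rJ rJ rONE]"
  define J where "J = (\<lambda>j N' R' k'. k' = k \<and> row_inv i j N' R' \<and> N' rF = N rF \<and> N' rJ = j)"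
  have loop: "ex W cs (While (CLess rJ 0) ?c) (n * (7 * n + 16) + 2) ?Q (N(rJ := 0)) R k"
  proof (rule ex_While_const[where I = J and J = n and T = "7 * n + 14"])
    have "regs (N(rJ := 0))" by (rule regs_frame[of N]) (use I in \<open>auto simp: row_inv_def\<close>)
    then show "J 0 (N(rJ := 0)) R k" using I by (simp add: J_def row_inv_def)
  next
    fix j N1 R1 k1 assume j: "j < n" and J: "J j N1 R1 k1"
    then have v: "regs N1" "memAB R1" "memC (cur i j) R1" "tab (2 * M * n) R1" "N1 rI = i" "N1 rJ = j" "k1 = k" "N1 rF = N rF"
      by (auto simp: row_inv_def J_def)
    note en = ex_entry[OF v(1,2,5) i v(6) j order_refl, of k]
    have "ex W cs ?c (7 * n + 14) (J (Suc j)) N1 R1 k"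
    proof (rule ex_SeqI[OF en, where bc = 1])
      fix N4 R4 k4
      assume a: "k4 = k \<and> (\<forall>r. r \<notin> dotregs \<longrightarrow> N4 r = N1 r) \<and>
        same (R1(2 * (n * n) + i * n + j := mat_mult n A B i j)) R4"
      then have k4: "k4 = k" and f4: "\<And>r. r \<notin> dotregs \<Longrightarrow> N4 r = N1 r" by auto
      have r4: "regs N4" by (rule regs_frame[OF v(1)]) (use f4 in auto)
      from entry_mem[OF i j _ v(2-4)] a
      have m4: "memAB R4" "memC (\<lambda>i' j'. if i' = i \<and> j' = j then mat_mult n A B i j else cur i j i' j') R4"
        "tab (2 * M * n) R4" by blast+
      have "memC (cur i (Suc j)) R4"
        by (rule memC_cong[OF m4(2)]) (auto simp: cur_def)
      moreover have w4: "N4 rI = i" "N4 rJ = j" "N4 rF = N rF" "N4 rONE = 1"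
        using f4 v r4 by (auto simp: regs_def)
      moreover have "regs (N4(rJ := Suc j))" by (rule regs_frame[OF r4]) auto
      ultimately have "J (Suc j) (N4(rJ := Suc j)) R4 k" using m4 by (simp add: row_inv_def J_def)
      moreover have "Suc j < W" using j W_lin by linarith
      ultimately show "ex W cs (Block [NAdd rJ rJ rONE]) 1 (J (Suc j)) N4 R4 k4"
        unfolding k4 using w4 by (intro ex_Block) auto
    qed simp
    then show "cval (CLess rJ 0) N1 R1 \<and> ex W cs ?c (7 * n + 14) (J (Suc j)) N1 R1 k1"
      using v j by (simp add: regs_def)
  next
    fix N1 R1 k1 assume "J n N1 R1 k1"
    then show "\<not> cval (CLess rJ 0) N1 R1 \<and> ?Q N1 R1 k1"
      by (auto simp: J_def row_inv_def regs_def)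
  qed simp
  show ?thesis
    by (rule ex_Block_Seq[where bc = "n * (7 * n + 16) + 2"])
      (use loop b W_lin in auto)
qed

section \<open>Cost accounting for the rows\<close>

definition row_cost :: nat where
  "row_cost = M * (42 * n + 120) + 7 * n + 25"

definition row_time :: "nat \<Rightarrow> nat \<Rightarrow> nat" where
  "row_time F r = (if F * M < n * n then (r + 1) * row_cost else n * (7 * n + 16)) + 8"

text \<open>The content of \<open>rF\<close> when row \<open>i\<close> is reached. Recomputed rows
  leave it unchanged, so it is constant once the threshold has been reached.\<close>

fun fixes_upto :: "nat \<Rightarrow> nat" where
  "fixes_upto 0 = 0"
| "fixes_upto (Suc i) = fixes_upto i + (if fixes_upto i * M < n * n then errs i 0 else 0)"

lemma fixes_upto_le: "fixes_upto i \<le> (\<Sum>i'<i. errs i' 0)"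
  by (induction i) auto

lemma fixes_upto_le_mult: "fixes_upto i \<le> i * n"
proof (induction i)
  case (Suc i)
  then show ?case using errs_le[of i 0] by (auto intro: add_mono)
qed simp

lemma ex_row:
  assumes G: "good n M E cs" and i: "i < n" and I: "row_inv i 0 N R" and F: "N rF = fixes_upto i"
  shows "ex W cs row_com (row_time (fixes_upto i) (errs i 0))
     (\<lambda>N' R' k'. k' = k \<and> row_inv (Suc i) 0 N' R' \<and> N' rF = fixes_upto (Suc i)) N R k"
proof -
  let ?F = "fixes_upto i"
  let ?Q = "\<lambda>N' R' k'. k' = k \<and> row_inv i n N' R' \<and> N' rF = fixes_upto (Suc i)"
  have F1: "?F \<le> n * n" "?F + errs i 0 \<le> n * n"
    using fixes_upto_le_mult[of i] errs_le[of i 0] idx_end[OF i] by linarith+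
  \<comment> \<open>The counter is at most \<open>n * n\<close>, so the product compared with the
    threshold fits into a word.\<close>
  have "?F * M \<le> n * n * M" using F1 by (intro mult_le_mono1)
  then have w: "?F * M < W" using W_large mult.commute[of "n * n" M] by (simp only: mult.assoc)
  define N1 where "N1 = N(rAUX := ?F * M)"
  have r1: "regs N1" by (rule regs_frame[of N]) (use I in \<open>auto simp: row_inv_def N1_def\<close>)
  have I1: "row_inv i 0 N1 R" using I r1 by (simp add: row_inv_def N1_def)
  have F2: "N1 rF = ?F" "N1 rAUX = ?F * M" "N1 rNN = n * n" using F r1 by (auto simp: N1_def regs_def)
  have last: "ex W cs (Block [NAdd rI rI rONE]) 1
     (\<lambda>N' R' k'. k' = k \<and> row_inv (Suc i) 0 N' R' \<and> N' rF = fixes_upto (Suc i)) N2 R2 k2"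
    if "?Q N2 R2 k2" for N2 R2 k2
  proof -
    have v: "regs N2" "memAB R2" "memC (cur i n) R2" "tab (2 * M * n) R2" "N2 rI = i" using that by (auto simp: row_inv_def)
    have "regs (N2(rI := Suc i))" by (rule regs_frame[OF v(1)]) auto
    moreover have "memC (cur (Suc i) 0) R2" by (rule memC_cong[OF v(3)]) (auto simp: cur_def less_Suc_eq)
    moreover have "N2 rONE = 1" using v by (simp add: regs_def)
    moreover have "Suc i < W" using i W_lin by linarith
    ultimately show ?thesis using that v by (intro ex_Block) (auto simp: row_inv_def)
  qed
  let ?t = "if ?F * M < n * n then (errs i 0 + 1) * row_cost else n * (7 * n + 16)"
  have cond: "ex W cs (Cond (CLess rAUX rNN)
       (Block [NConst rHI 0] ;;
        While (CLess rHI rN1)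
          (search_com ;;
           Cond (CLess rHI rN1)
             (Block [NSub rJ rHI rONE] ;; entry_com ;; Block [NAdd rF rF rONE])
             (Block [])))
       (Block [NConst rJ 0] ;; While (CLess rJ 0) (entry_com ;; Block [NAdd rJ rJ rONE]))) (?t + 5) ?Q N1 R k"
  proof (cases "?F * M < n * n")
    case True
    show ?thesis
    proof (rule ex_Cond[where ba = "?t + 3" and bc = 0])
      show "ex W cs (Block [NConst rHI 0] ;;
        While (CLess rHI rN1)
          (search_com ;;
           Cond (CLess rHI rN1)
             (Block [NSub rJ rHI rONE] ;; entry_com ;; Block [NAdd rF rF rONE])
             (Block []))) (?t + 3) ?Q N1 R k"
        by (rule ex_mono[OF ex_search_row[OF G i I1 F2(1) F1(2) order_refl, of k]])
          (use True in \<open>auto simp: row_cost_def\<close>)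
    qed (use True F2 in auto)
  next
    case False
    show ?thesis
    proof (rule ex_Cond[where ba = 0 and bc = "?t + 3"])
      show "ex W cs (Block [NConst rJ 0] ;; While (CLess rJ 0) (entry_com ;; Block [NAdd rJ rJ rONE])) (?t + 3) ?Q N1 R k"
        by (rule ex_mono[OF ex_brute_row[OF i I1 order_refl, of k]]) (use False F2 in auto)
    qed (use False F2 in auto)
  qed
  have M: "N rM = M" using I by (simp add: row_inv_def regs_def)
  show ?thesis unfolding row_com_def
  proof (rule ex_Block_Seq[where bc = "?t + 7"])
    have "ex W cs (Cond (CLess rAUX rNN)
       (Block [NConst rHI 0] ;;
        While (CLess rHI rN1)
          (search_com ;;
           Cond (CLess rHI rN1)
             (Block [NSub rJ rHI rONE] ;; entry_com ;; Block [NAdd rF rF rONE])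
             (Block [])))
       (Block [NConst rJ 0] ;; While (CLess rJ 0) (entry_com ;; Block [NAdd rJ rJ rONE])) ;; Block [NAdd rI rI rONE]) (?t + 7)
      (\<lambda>N' R' k'. k' = k \<and> row_inv (Suc i) 0 N' R' \<and> N' rF = fixes_upto (Suc i)) N1 R k"
      by (rule ex_SeqI[OF cond last]) auto
    then show "wpb W cs [NMul rAUX rF rM] (ex W cs (Cond (CLess rAUX rNN)
       (Block [NConst rHI 0] ;;
        While (CLess rHI rN1)
          (search_com ;;
           Cond (CLess rHI rN1)
             (Block [NSub rJ rHI rONE] ;; entry_com ;; Block [NAdd rF rF rONE])
             (Block [])))
       (Block [NConst rJ 0] ;; While (CLess rJ 0) (entry_com ;; Block [NAdd rJ rJ rONE])) ;; Block [NAdd rI rI rONE]) (?t + 7)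
      (\<lambda>N' R' k'. k' = k \<and> row_inv (Suc i) 0 N' R' \<and> N' rF = fixes_upto (Suc i))) N R k"
      using w F M by (simp only: wpb.simps N1_def simp_thms)
  qed (simp add: row_time_def)
qed

end

definition rows_com :: com where
  "rows_com = Block [NConst rI 0, NConst rF 0] ;; While (CLess rI 0) row_com"

context correction
begin

lemma ex_rows:
  assumes G: "good n M E cs" and N: "regs N" and R: "memAB R" "memC C R" "tab (2 * M * n) R"
  shows "ex W cs rows_com ((\<Sum>i<n. row_time (fixes_upto i) (errs i 0) + 2) + 4)
     (\<lambda>N' R' k'. memC (mat_mult n A B) R') N R k"
  unfolding rows_com_def
proof (rule ex_Block_Seq[where bc = "(\<Sum>i<n. row_time (fixes_upto i) (errs i 0) + 2) + 2"])
  define N1 where "N1 = N(rI := 0, rF := 0)"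
  define J where "J = (\<lambda>i N' R' (k'::nat). k' = k \<and> row_inv i 0 N' R' \<and> N' rF = fixes_upto i)"
  have "regs N1" by (rule regs_frame[OF N]) (auto simp: N1_def)
  moreover have "memC (cur 0 0) R" by (rule memC_cong[OF R(2)]) (auto simp: cur_def)
  ultimately have J0: "J 0 N1 R k" using R by (simp add: J_def row_inv_def N1_def)
  have "ex W cs (While (CLess rI 0) row_com) ((\<Sum>i<n. row_time (fixes_upto i) (errs i 0) + 2) + 2)
     (\<lambda>N' R' k'. memC (mat_mult n A B) R') N1 R k"
  proof (rule ex_While[where I = J and J = n and T = "\<lambda>i. row_time (fixes_upto i) (errs i 0)", OF J0])
    fix i N' R' k' assume i: "i < n" and J: "J i N' R' k'"
    have "N' rI = i" "N' 0 = n" using J by (auto simp: J_def row_inv_def regs_def)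
    moreover have "ex W cs row_com (row_time (fixes_upto i) (errs i 0)) (J (Suc i)) N' R' k'"
      using ex_row[OF G i, of N' R' k] J unfolding J_def by simp
    ultimately show "cval (CLess rI 0) N' R' \<and> ex W cs row_com (row_time (fixes_upto i) (errs i 0)) (J (Suc i)) N' R' k'"
      using i by simp
  next
    fix N' R' k' assume J: "J n N' R' k'"
    then have "memC (cur n 0) R'" by (simp add: J_def row_inv_def)
    then have "memC (mat_mult n A B) R'" by (rule memC_cong) (auto simp: cur_def)
    then show "\<not> cval (CLess rI 0) N' R' \<and> memC (mat_mult n A B) R'"
      using J by (auto simp: J_def row_inv_def regs_def)
  qed simp
  then show "wpb W cs [NConst rI 0, NConst rF 0] (ex W cs (While (CLess rI 0) row_com) ((\<Sum>i<n. row_time (fixes_upto i) (errs i 0) + 2) + 2)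
     (\<lambda>N' R' k'. memC (mat_mult n A B) R')) N R k"
    using W_lin by (simp add: N1_def)
qed simp

text \<open>Amortization: each repair is charged one search, each row one further search for its
  final check. Naive rows occur only after the threshold has been reached, and from then on
  \<open>fixes_upto\<close> stays put.\<close>

lemma rows_time_le:
  "(\<Sum>i<j. row_time (fixes_upto i) (errs i 0) + 2) \<le>
     fixes_upto j * row_cost + j * (row_cost + 10) + (if fixes_upto j * M < n * n then 0 else j * (n * (7 * n + 16)))"
proof (induction j)
  case (Suc j)
  show ?case
  proof (cases "fixes_upto j * M < n * n")
    case True
    then show ?thesis using Suc by (simp add: row_time_def algebra_simps)
  next
    case False
    then show ?thesis using Suc by (simp add: row_time_def algebra_simps)
  qed
qed simp

text \<open>The threshold is checked between rows, so it is overshot by the errors of a single row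
  at most.\<close>

lemma fixes_upto_M: "fixes_upto j * M \<le> n * n + n * M"
proof (induction j)
  case (Suc j)
  have e: "errs j 0 * M \<le> n * M" using errs_le by (intro mult_le_mono1)
  show ?case
  proof (cases "fixes_upto j * M < n * n")
    case True
    then have "fixes_upto (Suc j) * M = fixes_upto j * M + errs j 0 * M" by (simp add: add_mult_distrib)
    then show ?thesis using e True by linarith
  next
    case False
    then show ?thesis using Suc by simp
  qed
qed simp

lemma sum_errs: "(\<Sum>i<n. errs i 0) = num_diff n C (mat_mult n A B)"
proof -
  have "{(i, j). i < n \<and> j < n \<and> C i j \<noteq> mat_mult n A B i j} = (SIGMA i:{..<n}. {j. 0 \<le> j \<and> j < n \<and> E i j \<noteq> 0})"
    by (auto simp: E_def)
  then show ?thesis unfolding num_diff_def errs_def by (simp add: card_SigmaI)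
qed

end

section \<open>The complete program\<close>

text \<open>\<open>K\<close> is a constant of the program text and does not depend on
  \<open>n\<close>. The logarithm is found at run time by doubling \<open>rPW\<close> until it
  reaches \<open>n\<close>.\<close>

definition setup_com :: "nat \<Rightarrow> com" where
  "setup_com K =
     Block [NConst rZ 0, NConst rONE 1, NConst rTWO 2, NMul rNN 0 0, NConst rLG 0, NConst rPW 1] ;;
     While (CLess rPW 0) (Block [NAdd rPW rPW rPW, NAdd rLG rLG rONE]) ;;
     Block [NConst rAUX K, NMul rM rAUX rLG, NAdd rM2 rM rM, NAdd rCB rNN rNN, NAdd rX1 rCB rNN,
       NAdd rX2 rX1 rONE, NAdd rX3 rX2 rONE, NAdd rTMP rX3 rONE, NAdd rVB rTMP rONE, NMul rVS rM2 0,
       NAdd rSB rVB rVS, NAdd rN1 0 rONE]"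

definition prog_com :: "nat \<Rightarrow> com" where
  "prog_com K = setup_com K ;; tables_com ;; rows_com"

definition prog :: "nat \<Rightarrow> instr list" where
  "prog K = comp 0 (prog_com K) @ [Halt]"

definition clog2 :: "nat \<Rightarrow> nat" where
  "clog2 n = (LEAST l. n \<le> 2 ^ l)"

lemma le_pow_clog2: "n \<le> 2 ^ clog2 n"
  unfolding clog2_def by (rule LeastI[of _ n]) (simp add: less_imp_le)

lemma pow_less_of_less_clog2: "l < clog2 n \<Longrightarrow> 2 ^ l < n"
  unfolding clog2_def using not_less_Least[of l "\<lambda>l. n \<le> 2 ^ l"] by auto

lemma clog2_le: "clog2 n \<le> n"
  unfolding clog2_def by (rule Least_le) (simp add: less_imp_le)

lemma clog2_pos: "2 \<le> n \<Longrightarrow> 1 \<le> clog2 n"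
  using le_pow_clog2[of n] by (cases "clog2 n") auto

text \<open>Minimality bounds the power of 2 with exponent \<open>clog2 n - 1\<close> by
  \<open>n\<close>, and ln 2 \<ge> 1/2 turns this into \<open>clog2 n\<close> - 1 \<le> 2 ln n. The
  lost 1 is at most ln n because n \<ge> 3 \<ge> e.\<close>

lemma clog2_le_ln:
  assumes "3 \<le> n" shows "real (clog2 n) \<le> 3 * ln (real n)"
proof -
  obtain l where l: "clog2 n = Suc l" using clog2_pos[of n] assms by (cases "clog2 n") auto
  have "real (2 ^ l) \<le> real n"
    using pow_less_of_less_clog2[of l n] l by (intro of_nat_mono) simp
  then have "(2::real) ^ l \<le> real n" by simp
  then have "ln ((2::real) ^ l) \<le> ln (real n)" using assms by (subst ln_le_cancel_iff) auto
  then have 1: "real l * ln 2 \<le> ln (real n)" by (simp add: ln_realpow)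
  \<comment> \<open>From e \<le> 3 \<le> 4 follows sqrt e \<le> 2, hence ln 2 \<ge> 1/2.\<close>
  have "exp (1/2 :: real) ^ 2 = exp (1/2 + 1/2)" by (simp only: power2_eq_square exp_add)
  then have "exp (1/2 :: real) ^ 2 \<le> 2 ^ 2" using exp_le by simp
  then have "exp (1/2 :: real) \<le> 2" by (rule power2_le_imp_le) simp
  then have "1/2 \<le> ln (2::real)" by (subst ln_ge_iff) auto
  then have "real l * (1/2) \<le> real l * ln 2" by (intro mult_left_mono) auto
  then have 2: "real l \<le> 2 * ln (real n)" using 1 by simp
  have "exp 1 \<le> real n" using exp_le assms by linarith
  then have "1 \<le> ln (real n)" using assms by (subst ln_ge_iff) auto
  then show ?thesis using 2 l by simp
qed

context correction
begin

lemma ex_setup: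
  fixes R :: "nat \<Rightarrow> 'a"
  assumes N: "N 0 = n" and M: "M = K * clog2 n" and K: "K < W"
  shows "ex W cs (setup_com K) (4 * clog2 n + 20) (\<lambda>N' R' k'. k' = k \<and> R' = R \<and> regs N') N R k"
proof -
  let ?w = "Block [NAdd rPW rPW rPW, NAdd rLG rLG rONE]"
  let ?b = "[NConst rAUX K, NMul rM rAUX rLG, NAdd rM2 rM rM, NAdd rCB rNN rNN, NAdd rX1 rCB rNN,
       NAdd rX2 rX1 rONE, NAdd rX3 rX2 rONE, NAdd rTMP rX3 rONE, NAdd rVB rTMP rONE, NMul rVS rM2 0,
       NAdd rSB rVB rVS, NAdd rN1 0 rONE]"
  define J where "J = (\<lambda>l N' R' k'. k' = k \<and> R' = R \<and> N' 0 = n \<and> N' rZ = 0 \<and> N' rONE = 1 \<and> N' rTWO = 2 \<and>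
     N' rNN = n * n \<and> N' rLG = l \<and> N' rPW = (2::nat) ^ l)"
  have last: "ex W cs (Block ?b) 12 (\<lambda>N' R' k'. k' = k \<and> R' = R \<and> regs N') N1 R1 k1"
    if J: "J (clog2 n) N1 R1 k1" for N1 R1 k1
  proof (rule ex_Block)
    have v: "k1 = k" "R1 = R" "N1 0 = n" "N1 rZ = 0" "N1 rONE = 1" "N1 rTWO = 2" "N1 rNN = n * n" "N1 rLG = clog2 n"
      using J by (auto simp: J_def)
    define q where "q = n * n"
    define p where "p = 2 * M * n"
    have "2 * M \<le> p" using mult_le_mono2[OF n_pos, of "2 * M"] by (simp add: p_def)
    then have w: "M < W" "2 * M < W" "p < W" "3 * q + 4 + p < W" "Suc n < W"
      using W_large unfolding p_def[symmetric] q_def[symmetric] by linarith+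
    have m: "(M + M) * n = p" "M + M = 2 * M" "K * clog2 n = M" using M by (auto simp: p_def)
    show "wpb W cs ?b (\<lambda>N' R' k'. k' = k \<and> R' = R \<and> regs N') N1 R1 k1"
      using K w by (simp add: v m regs_def flip: p_def q_def)
  qed simp
  define N1 where "N1 = N(rZ := 0, rONE := 1, rTWO := 2, rNN := n * n, rLG := 0, rPW := 1)"
  have loop: "ex W cs (While (CLess rPW 0) ?w) (4 * clog2 n + 2) (J (clog2 n)) N1 R k"
  proof (rule ex_While_const[where I = J and J = "clog2 n" and T = 2])
    show "J 0 N1 R k" using N by (simp add: J_def N1_def)
  next
    fix l N' R' k' assume l: "l < clog2 n" and J: "J l N' R' k'"
    have v: "k' = k" "R' = R" "N' 0 = n" "N' rZ = 0" "N' rONE = 1" "N' rTWO = 2" "N' rNN = n * n" "N' rLG = l" "N' rPW = 2 ^ l"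
      using J by (auto simp: J_def)
    have p: "2 ^ l < n" using pow_less_of_less_clog2[OF l] .
    define x where "x = (2::nat) ^ l"
    have w: "x + x < W" "Suc l < W" using p l clog2_le[of n] W_lin unfolding x_def by linarith+
    have "wpb W cs [NAdd rPW rPW rPW, NAdd rLG rLG rONE] (J (Suc l)) N' R' k'"
      using w by (simp add: v J_def x_def)
    then show "cval (CLess rPW 0) N' R' \<and> ex W cs ?w 2 (J (Suc l)) N' R' k'"
      using p v by (auto intro: ex_Block)
  next
    fix N' R' k' assume "J (clog2 n) N' R' k'"
    then show "\<not> cval (CLess rPW 0) N' R' \<and> J (clog2 n) N' R' k'" using le_pow_clog2[of n] by (simp add: J_def)
  qed simp
  show ?thesis unfolding setup_com_def
  proof (rule ex_Block_Seq[where bc = "4 * clog2 n + 14"])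
    have "ex W cs (While (CLess rPW 0) ?w ;; Block ?b) (4 * clog2 n + 14) (\<lambda>N' R' k'. k' = k \<and> R' = R \<and> regs N') N1 R k"
      by (rule ex_SeqI[OF loop, where bc = 12], rule last, assumption, simp)
    moreover have "n * n < W" "2 < W" using W_large by linarith+
    ultimately show "wpb W cs [NConst rZ 0, NConst rONE 1, NConst rTWO 2, NMul rNN 0 0, NConst rLG 0, NConst rPW 1]
      (ex W cs (While (CLess rPW 0) ?w ;; Block ?b) (4 * clog2 n + 14) (\<lambda>N' R' k'. k' = k \<and> R' = R \<and> regs N')) N R k"
      using N unfolding N1_def by simp
  qed simp
qed

text \<open>\<open>tab 0\<close> holds because the memory beyond the input is zero: the empty prefix
  sums are in place from the start.\<close>

lemma init_mem:
  assumes "init_conf n A B C = Running s"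
  shows "memAB (rmem s)" "memC C (rmem s)" "tab 0 (rmem s)" "s = mk 0 ((\<lambda>_. 0)(0 := n)) (rmem s) 0"
proof -
  have r: "rmem s a = (if a < n * n then A (a div n) (a mod n)
                           else if a < 2 * (n * n) then B ((a - n * n) div n) ((a - n * n) mod n)
                           else if a < 3 * (n * n) then C ((a - 2 * (n * n)) div n) ((a - 2 * (n * n)) mod n)
                           else 0)" for a using assms by (auto simp: init_conf_def)
  have dm: "(i * n + j) div n = i" "(i * n + j) mod n = j" if "j < n" for i j using that by auto
  show "memAB (rmem s)" unfolding memAB_def
  proof (intro allI impI)
    fix i j assume ij: "i < n" "j < n"
    define a where "a = i * n + j"
    have a: "a < n * n" "a div n = i" "a mod n = j" unfolding a_def using idx[OF ij] dm ij by auto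
    have "rmem s a = A i j" "rmem s (n * n + a) = B i j" using a by (auto simp: r)
    then show "rmem s (i * n + j) = A i j \<and> rmem s (n * n + i * n + j) = B i j" by (simp add: a_def add.assoc)
  qed
  show "memC C (rmem s)" unfolding memC_def
  proof (intro allI impI)
    fix i j assume ij: "i < n" "j < n"
    define a where "a = i * n + j"
    have a: "a < n * n" "a div n = i" "a mod n = j" unfolding a_def using idx[OF ij] dm ij by auto
    have "rmem s (2 * (n * n) + a) = C i j" using a by (auto simp: r)
    then show "rmem s (2 * (n * n) + i * n + j) = C i j" by (simp add: a_def add.assoc)
  qed
  show "tab 0 (rmem s)" by (simp add: tab_def r S_def)
  show "s = mk 0 ((\<lambda>_. 0)(0 := n)) (rmem s) 0" using assms by (auto simp: init_conf_def)
qed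

section \<open>Correctness and total running time of the program\<close>

definition total_time :: nat where
  "total_time = 4 * clog2 n + 2 * M * n * (8 * n + 17) + (\<Sum>i<n. row_time (fixes_upto i) (errs i 0) + 2) + 28"

lemma prog_correct:
  assumes G: "good n M E cs" and M: "M = K * clog2 n" and K: "K < W" and T: "total_time \<le> T"
  shows "output_ok n (mat_mult n A B) (run (prog K) W cs T (init_conf n A B C))"
proof -
  obtain s where s: "init_conf n A B C = Running s" by (simp add: init_conf_def)
  note i = init_mem[OF s]
  let ?N = "(\<lambda>_. 0)(0 := n) :: nat \<Rightarrow> nat"
  \<comment> \<open>One step of the budget is kept for \<open>Halt\<close>.\<close>
  have ex: "ex W cs (prog_com K) (total_time - 1) (\<lambda>N' R' k'. memC (mat_mult n A B) R') ?N (rmem s) 0"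
    unfolding prog_com_def
  proof -
    let ?S = "\<Sum>i<n. row_time (fixes_upto i) (errs i 0) + 2"
    let ?Q = "\<lambda>(N' :: nat \<Rightarrow> nat) R' (k' :: nat). memC (mat_mult n A B) R'"
    have rest: "ex W cs (tables_com ;; rows_com) (2 * M * n * (8 * n + 17) + 3 + (?S + 4)) ?Q N1 R1 k1"
      if a: "k1 = 0 \<and> R1 = rmem s \<and> regs N1" for N1 R1 k1
    proof -
      have "ex W cs tables_com (2 * M * n * (8 * n + 17) + 3)
         (\<lambda>N' R' k'. regs N' \<and> memAB R' \<and> memC C R' \<and> tab (2 * M * n) R') N1 R1 0"
        by (rule ex_tables) (use a i in auto)
      then have "ex W cs (tables_com ;; rows_com) (2 * M * n * (8 * n + 17) + 3 + (?S + 4)) ?Q N1 R1 0"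
      proof (rule ex_SeqI[where bc = "?S + 4"])
        fix N2 R2 k2 assume "regs N2 \<and> memAB R2 \<and> memC C R2 \<and> tab (2 * M * n) R2"
        then show "ex W cs rows_com (?S + 4) ?Q N2 R2 k2" by (intro ex_rows G) auto
      qed simp
      then show ?thesis using a by simp
    qed
    have su: "ex W cs (setup_com K) (4 * clog2 n + 20) (\<lambda>N' R' k'. k' = 0 \<and> R' = rmem s \<and> regs N') ?N (rmem s) 0"
      by (rule ex_setup[OF _ M K]) simp
    show "ex W cs (setup_com K ;; tables_com ;; rows_com) (total_time - 1) ?Q ?N (rmem s) 0"
    proof (rule ex_SeqI[OF su])
      fix N1 R1 and k1 :: nat assume "k1 = 0 \<and> R1 = rmem s \<and> regs N1"
      then show "ex W cs (tables_com ;; rows_com) (2 * M * n * (8 * n + 17) + 3 + (?S + 4)) ?Q N1 R1 k1" by (rule rest)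
    next
      show "4 * clog2 n + 20 + (2 * M * n * (8 * n + 17) + 3 + (?S + 4)) \<le> total_time - 1"
        unfolding total_time_def by linarith
    qed
  qed
  have c: "code_at (prog K) 0 (comp 0 (prog_com K))" by (auto simp: code_at_def prog_def)
  from ex[unfolded ex_def, rule_format, OF c] obtain t N' R' k' where t: "t \<le> total_time - 1"
    "run (prog K) W cs t (Running (mk 0 ?N (rmem s) 0)) = Running (mk (len (prog_com K)) N' R' k')" "memC (mat_mult n A B) R'"
    by auto
  have st: "step (prog K) W cs (Running (mk (len (prog_com K)) N' R' k')) = Halted (mk (len (prog_com K)) N' R' k')"
    by (simp add: prog_def nth_append)
  \<comment> \<open>Halted configurations persist, so the output can be read at any later time
    \<open>T\<close>.\<close>
  have h: "run (prog K) W cs m (Halted x) = Halted x" for m and x :: "'a st" by (induction m) (simp_all add: run_Suc)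
  have "T = t + Suc (T - t - 1)" using t(1) T by (simp add: total_time_def)
  then have "run (prog K) W cs T (init_conf n A B C) = Halted (mk (len (prog_com K)) N' R' k')"
    using t(2) i(4) s st h by (metis run_add run_Suc)
  then show ?thesis using t(3) by (simp add: output_ok_def memC_def)
qed

text \<open>\<open>Y\<close> merges the two regimes, \<open>M\<close> per error below the threshold
  and n^2 above it. The constant 217 is 194 for the searches plus 23 for naive rows; 500 covers 194
  for the overshoot, 204 for one search per row, 50 for the tables, and the setup.\<close>

lemma total_time_le:
  assumes M: "M \<ge> 1" "clog2 n \<le> M"
  defines "Y \<equiv> min (M * num_diff n C (mat_mult n A B)) (n * n)"
  shows "total_time \<le> 500 * (M * (n * n)) + 217 * (n * Y)"
proof -
  let ?F = "fixes_upto n"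
  let ?k = "num_diff n C (mat_mult n A B)"
  let ?m = "M * (n * n)"
  have Mn: "M * n \<le> ?m" "n \<le> M * n" "M \<le> ?m" "1 \<le> M * n"
    using n_pos M mult_le_mono[of 1 n M "M * n"] mult_le_mono[of 1 M 1 n] by (auto simp: mult_ac)
  \<comment> \<open>194 = 42 + 120 + 7 + 25, with \<open>M\<close>, \<open>n\<close> and 1 all
    bounded by \<open>M * n\<close>.\<close>
  have rc: "row_cost \<le> 194 * (M * n)"
  proof -
    have "M \<le> M * n" using n_pos by simp
    moreover have "row_cost = 42 * (M * n) + 120 * M + 7 * n + 25" by (simp add: row_cost_def algebra_simps)
    ultimately show ?thesis using Mn by linarith
  qed
  have F: "?F \<le> ?k" using fixes_upto_le[of n] sum_errs by simp
  have FM: "?F * M \<le> Y + n * M"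
  proof (cases "M * ?k \<le> n * n")
    case True
    then have "Y = M * ?k" by (simp add: Y_def)
    moreover have "?F * M \<le> M * ?k" using F by (simp add: mult.commute)
    ultimately show ?thesis by linarith
  next
    case False
    then have "Y = n * n" by (simp add: Y_def)
    then show ?thesis using fixes_upto_M[of n] by simp
  qed
  have "?F * row_cost \<le> ?F * (194 * (M * n))" using rc by (rule mult_le_mono2)
  also have "\<dots> = 194 * n * (?F * M)" by simp
  also have "\<dots> \<le> 194 * n * (Y + n * M)" using FM by (rule mult_le_mono2)
  also have "\<dots> = 194 * (n * Y) + 194 * ?m" by (simp add: algebra_simps)
  finally have 1: "?F * row_cost \<le> 194 * (n * Y) + 194 * ?m" .
  have "n * (row_cost + 10) \<le> n * (204 * (M * n))" using rc Mn by (intro mult_le_mono2) linarith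
  then have 2: "n * (row_cost + 10) \<le> 204 * ?m" by (simp add: mult_ac)
  have 3: "(if ?F * M < n * n then 0 else n * (n * (7 * n + 16))) \<le> 23 * (n * Y)"
  proof (cases "?F * M < n * n")
    case False
    then have "n * n \<le> M * ?k" using mult_le_mono1[OF F, of M] mult.commute[of ?k M] by linarith
    then have Y: "Y = n * n" by (simp add: Y_def)
    have "n * (7 * n + 16) \<le> n * (23 * n)" using n_pos by (intro mult_le_mono2) linarith
    then have "n * (n * (7 * n + 16)) \<le> n * (n * (23 * n))" by (rule mult_le_mono2)
    then show ?thesis using False Y by simp
  qed simp
  have "2 * M * n * (8 * n + 17) \<le> 2 * M * n * (25 * n)" using n_pos by (intro mult_le_mono2) linarith
  then have 4: "2 * M * n * (8 * n + 17) \<le> 50 * ?m" by (simp add: mult_ac)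
  show ?thesis using rows_time_le[of n] 1 2 3 4 M(2) Mn unfolding total_time_def by linarith
qed

end

section \<open>The stated time bound, the success probability and the word size\<close>

lemma time_bound:
  fixes n k K :: nat
  assumes n: "3 \<le> n" and K: "1 \<le> K" and M: "M = K * clog2 n"
  shows "real (500 * (M * (n * n)) + 217 * (n * min (M * k) (n * n))) \<le>
    2200 * real K * (real n * sqrt (ln (real n)) + sqrt (real k) * real (min k n)) * real n * sqrt (ln (real n))"
proof -
  define L where "L = ln (real n)"
  let ?Y = "min (M * k) (n * n)"
  let ?Z = "sqrt (real k) * real (min k n) * real n * sqrt L"
  let ?X = "real n * real n * L"
  have L: "0 \<le> L" using n by (simp add: L_def)
  have Z: "0 \<le> ?Z" using L by simp
  have X: "0 \<le> ?X" using L by simp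
  have MleL: "real M \<le> 3 * real K * L"
    using mult_left_mono[OF clog2_le_ln[OF n], of "real K"] by (simp add: M L_def)
  have 1: "real M * (real n * real n) \<le> 3 * real K * ?X"
    using mult_right_mono[OF MleL, of "real n * real n"] by (simp add: mult_ac)
  have 2: "real n * real ?Y \<le> 3 * real K * (?X + ?Z)"
  proof (cases "k \<le> n")
    \<comment> \<open>Few errors: the repairs cost at most \<open>M * n * n\<close> up to a
      constant, which the first summand of the bound already pays.\<close>
    case True
    have "real ?Y \<le> real (M * k)" by (intro of_nat_mono) simp
    then have "real n * real ?Y \<le> real n * (real M * real k)" by (intro mult_left_mono) simp_all
    also have "\<dots> \<le> real n * (real M * real n)" using True by (intro mult_left_mono) auto
    also have "\<dots> \<le> 3 * real K * ?X" using 1 by (simp add: mult_ac)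
    also have "\<dots> \<le> 3 * real K * (?X + ?Z)" using Z by (intro mult_left_mono) auto
    finally show ?thesis .
  next
    case False
    \<comment> \<open>Bound the minimum of two numbers by their geometric mean.\<close>
    have "real (?Y * ?Y) \<le> real ((M * k) * (n * n))" by (intro of_nat_mono mult_le_mono) simp_all
    then have "real ?Y * real ?Y \<le> (real M * real k) * (real n * real n)" by (simp only: of_nat_mult)
    also have "\<dots> \<le> (3 * real K * L * real k) * (real n * real n)"
      using MleL by (intro mult_right_mono) auto
    finally have "real ?Y \<le> sqrt ((3 * real K) * (L * real k) * (real n * real n))"
      by (intro real_le_rsqrt) (simp add: power2_eq_square mult_ac)
    also have "\<dots> = sqrt (3 * real K) * (sqrt L * sqrt (real k)) * real n"
      by (simp add: real_sqrt_mult)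
    also have "\<dots> \<le> (3 * real K) * (sqrt L * sqrt (real k)) * real n"
    proof -
      \<comment> \<open>As 3 K is at least 1, it dominates its own root; this keeps the final
        constant linear in \<open>K\<close>.\<close>
      have "sqrt (3 * real K) \<le> 3 * real K" using K by (intro real_le_lsqrt) (auto simp: power2_eq_square)
      then show ?thesis using L by (intro mult_right_mono) auto
    qed
    finally have "real n * real ?Y \<le> real n * ((3 * real K) * (sqrt L * sqrt (real k)) * real n)"
      by (intro mult_left_mono) auto
    also have "\<dots> = 3 * real K * ?Z" using False by (simp add: mult_ac)
    also have "\<dots> \<le> 3 * real K * (?X + ?Z)" using X by (intro mult_left_mono) auto
    finally show ?thesis .
  qed
  have 3: "real K * ?X \<le> real K * (?X + ?Z)" "0 \<le> real K * (?X + ?Z)"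
    using X Z by (auto intro!: mult_left_mono mult_nonneg_nonneg)
  have "real (500 * (M * (n * n)) + 217 * (n * ?Y)) = 500 * (real M * (real n * real n)) + 217 * (real n * real ?Y)"
    by simp
  \<comment> \<open>2200 exceeds 3 * (500 + 217) = 2151, where 3 comes from
    \<open>clog2_le_ln\<close>.\<close>
  also have "\<dots> \<le> 2200 * (real K * (?X + ?Z))" using 1 2 3 by linarith
  also have "\<dots> = 2200 * real K * (real n * sqrt L + sqrt (real k) * real (min k n)) * real n * sqrt L"
    using L by (simp add: algebra_simps)
  finally show ?thesis unfolding L_def .
qed

text \<open>Each coin string gives its own instance of the locale, and outside the bad event that
  instance is a successful run. So failures are counted by bad strings alone.\<close>

lemma succ_prob_ge:
  fixes A B C :: "nat \<Rightarrow> nat \<Rightarrow> 'a::ring_1"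
  assumes n: "1 \<le> n" and W: "2 * M * n * n + 2 * M * n + 5 * (n * n) + 5 * n + 20 < W"
    and M: "1 \<le> M" "M = K * clog2 n" "clog2 n \<le> M" and K: "K < W"
    and T: "500 * (M * (n * n)) + 217 * (n * min (M * num_diff n C (mat_mult n A B)) (n * n)) \<le> T"
  shows "succ_prob (prog K) W T n A B C \<ge> 1 - real n * real (n + 1) * real n ^ 5 * (7/8) ^ M"
proof -
  define D where "D = (\<lambda>i j. mat_mult n A B i j - C i j)"
  let ?ok = "{bs :: bool list. length bs = T \<and>
        output_ok n (mat_mult n A B) (run (prog K) W (\<lambda>i. i < length bs \<and> bs ! i) T (init_conf n A B C))}"
  let ?bad = "{bs. length bs = T \<and> \<not> good n M D (coins bs)}"
  have ok: "bs \<in> ?ok" if l: "length bs = T" and g: "good n M D (coins bs)" for bs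
  proof -
    interpret correction n M W A B C "coins bs" by unfold_locales (use n W in auto)
    have E: "E = D" by (intro ext) (simp add: E_def D_def)
    have "total_time \<le> T" using total_time_le[OF M(1,3)] T by linarith
    then have "output_ok n (mat_mult n A B) (run (prog K) W (coins bs) T (init_conf n A B C))"
      using prog_correct[of K T] g E M(2) K by simp
    then show ?thesis using l by (simp add: coins_def)
  qed
  have fin: "finite ?ok" "finite ?bad" by (auto intro: rev_finite_subset[OF finite_bool_lists[of T]])
  have "2 ^ T = card {bs :: bool list. length bs = T}" by (simp add: card_bool_lists)
  also have "\<dots> \<le> card (?ok \<union> ?bad)"
  proof (rule card_mono)
    show "{bs. length bs = T} \<subseteq> ?ok \<union> ?bad" using ok by blast
  qed (use fin in simp)
  also have "\<dots> \<le> card ?ok + card ?bad" by (rule card_Un_le)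
  finally have "real (2 ^ T) \<le> real (card ?ok + card ?bad)" by (rule of_nat_mono)
  then have c: "2 ^ T \<le> real (card ?ok) + real (card ?bad)" by simp
  \<comment> \<open>The bad event is about the first \<open>2 * n * M\<close> coins, so the strings
    of length \<open>T\<close> must be at least that long.\<close>
  have "2 * n * M \<le> 500 * (M * (n * n))"
  proof -
    have "1 * (n * M) \<le> n * (n * M)" using n by (intro mult_le_mono1)
    then show ?thesis by (simp add: mult_ac)
  qed
  then have "2 * n * M \<le> T" using T by linarith
  then have b: "real (card ?bad) \<le> real n * real (n + 1) * real n ^ 5 * (7/8) ^ M * 2 ^ T" by (rule card_not_good)
  have "(1 - real n * real (n + 1) * real n ^ 5 * (7/8) ^ M) * 2 ^ T \<le> real (card ?ok)"
    using c b by (simp only: left_diff_distrib)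
  then show ?thesis unfolding succ_prob_def by (subst le_divide_eq) simp
qed

text \<open>The origin of \<open>6 * (a + 8)\<close>: six steps contribute (7/8)^6 \<le> 1/2,
  \<open>clog2 n\<close> groups of six contribute 1/n, and this is repeated a + 8 times. Of these
  powers of 1/n, eight pay for the n (n + 1) states of the union bound and the initial potential
  n^5.\<close>

lemma failure_bound:
  assumes n: "2 \<le> n" and \<alpha>: "\<alpha> \<le> real a"
  shows "real n * real (n + 1) * real n ^ 5 * (7/8) ^ (6 * (a + 8) * clog2 n) \<le> real n powr - \<alpha>"
proof -
  have n0: "real n > 0" "real n \<ge> 1" using n by auto
  have "(7/8 :: real) ^ 6 \<le> 1/2" by (simp add: power_numeral_reduce)
  then have "((7/8 :: real) ^ 6) ^ (clog2 n * (a + 8)) \<le> (1/2) ^ (clog2 n * (a + 8))" by (intro power_mono) auto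
  also have "\<dots> = 1 / (2 ^ clog2 n) ^ (a + 8)" by (simp add: power_mult power_one_over)
  also have "\<dots> \<le> 1 / real n ^ (a + 8)"
  proof (rule divide_left_mono)
    have "real n \<le> real (2 ^ clog2 n)" using le_pow_clog2 by (rule of_nat_mono)
    then show "real n ^ (a + 8) \<le> (2 ^ clog2 n) ^ (a + 8)" by (intro power_mono) auto
  qed (use n0 in auto)
  finally have p: "(7/8 :: real) ^ (6 * (a + 8) * clog2 n) \<le> 1 / real n ^ (a + 8)"
    by (simp add: mult_ac flip: power_mult)
  have "n + 1 \<le> n * n" using mult_le_mono1[OF n, of n] n by linarith
  then have q: "real (n + 1) \<le> real n * real n" by (simp flip: of_nat_mult)
  have "real n * real (n + 1) * real n ^ 5 * (7/8) ^ (6 * (a + 8) * clog2 n)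
      \<le> real n * (real n * real n) * real n ^ 5 * (1 / real n ^ (a + 8))"
    using p q by (intro mult_mono) auto
  also have "\<dots> = 1 / real n ^ a" using n0 by (simp add: power_add power_numeral_reduce field_simps)
  also have "\<dots> = real n powr - real a" using n0 by (simp add: powr_minus powr_realpow divide_inverse)
  also have "\<dots> \<le> real n powr - \<alpha>" using \<alpha> n0 by (intro powr_mono) auto
  finally show ?thesis .
qed

theorem theorem4:
  fixes dummy :: "'a::ring_1"
  shows "\<forall>\<alpha>::real. \<alpha> \<ge> 1 \<longrightarrow>
    (\<exists>(P :: instr list) (c :: real) (d :: nat) (N0 :: nat). c > 0 \<and>
      (\<forall>n \<ge> N0. \<forall>(A :: nat \<Rightarrow> nat \<Rightarrow> 'a) (B :: nat \<Rightarrow> nat \<Rightarrow> 'a) (C' :: nat \<Rightarrow> nat \<Rightarrow> 'a).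
         let k = num_diff n C' (mat_mult n A B);
             T = nat \<lceil>c * (real n * sqrt (ln (real n)) + sqrt (real k) * real (min k n))
                        * real n * sqrt (ln (real n))\<rceil>
         in succ_prob P ((n + 2) ^ d) T n A B C' \<ge> 1 - real n powr (- \<alpha>)))"
proof (intro allI impI)
  fix \<alpha> :: real assume "\<alpha> \<ge> 1"
  define a where "a = nat \<lceil>\<alpha>\<rceil>"
  have a: "\<alpha> \<le> real a" unfolding a_def by linarith
  define K where "K = 6 * (a + 8)"
  have K: "K \<ge> 1" by (simp add: K_def)
  let ?c = "2200 * real K"
  have main: "succ_prob (prog K) ((n + 2) ^ 5) (nat \<lceil>?c * (real n * sqrt (ln (real n)) +
        sqrt (real (num_diff n C' (mat_mult n A B))) * real (min (num_diff n C' (mat_mult n A B)) n)) * real n * sqrt (ln (real n))\<rceil>) n A B C'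
      \<ge> 1 - real n powr (- \<alpha>)"
    if n: "n \<ge> K + 3" for n and A B C' :: "nat \<Rightarrow> nat \<Rightarrow> 'a"
  proof -
    let ?W = "(n + 2) ^ 5"
    define M where "M = K * clog2 n"
    let ?k = "num_diff n C' (mat_mult n A B)"
    define T where "T = nat \<lceil>?c * (real n * sqrt (ln (real n)) + sqrt (real ?k) * real (min ?k n)) * real n * sqrt (ln (real n))\<rceil>"
    have n3: "3 \<le> n" "K \<le> n" using n by auto
    have cl: "1 \<le> clog2 n" "clog2 n \<le> n" using clog2_pos clog2_le n3 by auto
    \<comment> \<open>The condition \<open>n \<ge> K + 3\<close> gives \<open>K \<le> n\<close> and
      hence \<open>M \<le> n * n\<close>. The table addresses are then of order n^4, which a fifth
      power dominates.\<close>
    have M1: "1 \<le> M" "clog2 n \<le> M" "M \<le> n * n"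
      using K cl n3 mult_le_mono[of K n "clog2 n" n] mult_le_mono[of 1 K "clog2 n" "clog2 n"] by (auto simp: M_def)
    have e: "?W = n * n * (n * n) * n + 10 * (n * n * (n * n)) + 40 * (n * n * n) + 80 * (n * n) + 80 * n + 32"
      by (simp add: power_numeral_reduce algebra_simps)
    have "M * (n * n) \<le> n * n * (n * n)" "M * n \<le> n * n * n" using M1(3) by (auto intro: mult_le_mono1)
    moreover have "2 * M * n * n = 2 * (M * (n * n))" "2 * M * n = 2 * (M * n)" by auto
    ultimately have W: "2 * M * n * n + 2 * M * n + 5 * (n * n) + 5 * n + 20 < ?W" unfolding e by linarith
    have KW: "K < ?W" using n3 unfolding e by linarith
    have "500 * (M * (n * n)) + 217 * (n * min (M * ?k) (n * n)) \<le> T"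
      using time_bound[OF n3(1) K M_def, of ?k] unfolding T_def by linarith
    from succ_prob_ge[OF _ W M1(1) M_def M1(2) KW this]
    have "succ_prob (prog K) ?W T n A B C' \<ge> 1 - real n * real (n + 1) * real n ^ 5 * (7/8) ^ M" using n3 by simp
    moreover have "real n * real (n + 1) * real n ^ 5 * (7/8) ^ M \<le> real n powr - \<alpha>"
      unfolding M_def K_def using failure_bound[OF _ a, of n] n3 by simp
    ultimately show ?thesis unfolding T_def by linarith
  qed
  show "\<exists>(P :: instr list) (c :: real) (d :: nat) (N0 :: nat). c > 0 \<and>
      (\<forall>n \<ge> N0. \<forall>(A :: nat \<Rightarrow> nat \<Rightarrow> 'a) (B :: nat \<Rightarrow> nat \<Rightarrow> 'a) (C' :: nat \<Rightarrow> nat \<Rightarrow> 'a).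
         let k = num_diff n C' (mat_mult n A B);
             T = nat \<lceil>c * (real n * sqrt (ln (real n)) + sqrt (real k) * real (min k n))
                        * real n * sqrt (ln (real n))\<rceil>
         in succ_prob P ((n + 2) ^ d) T n A B C' \<ge> 1 - real n powr (- \<alpha>))"
    unfolding Let_def using main K
    by (intro exI[of _ "prog K"] exI[of _ ?c] exI[of _ 5] exI[of _ "K + 3"]) auto
qed

end
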